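(* Let $n\in\mathbb{Z}$ and let $BS(n,1)=\langle a,t \mid t^{-1}a^n t=a\rangle$. Then the Twisted Conjugacy Problem is solvable in $BS(n,1)$; that is, there is an algorithm which, given an automorphism $\varphi\in\operatorname{Aut}(BS(n,1))$ (given by words in $a^{\pm1},t^{\pm1}$ representing the images of the generators $a$ and $t$) and two words $u,v$ on the generators $a,t$ (elements of the free group $F(\{a,t\})$), decides whether $u$ and $v$ represent $\varphi$-twisted conjugate elements of $BS(n,1)$.
   Context: Automorphisms are written with the argument on the left: $x\varphi$ denotes the image of $x$ under $\varphi$. For a group $G$ and $\varphi\in\operatorname{Aut}(G)$, two elements $u,v\in G$ are $\varphi$-twisted conjugate, written $u\sim_\varphi v$, if there exists $x\in G$ such that $v=(x\varphi)^{-1}ux$ in $G$. *)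

theory Defs
  imports "HOL-Algebra.Bij" "HOL-Library.Nat_Bijection"
begin

text \<open>
  A letter \<open>(g, True)\<close> stands for the generator \<open>g\<close> and \<open>(g, False)\<close> for its formal inverse.
  A word need not be freely reduced; the free group on \<open>'g\<close> is the case of an empty set of
  relations.
\<close>

type_synonym 'g word = "('g \<times> bool) list"

definition inv_letter :: "'g \<times> bool \<Rightarrow> 'g \<times> bool" where
  "inv_letter x = (fst x, \<not> snd x)"

definition gen_pow :: "'g \<Rightarrow> int \<Rightarrow> 'g word" where
  "gen_pow g k = replicate (nat \<bar>k\<bar>) (g, 0 \<le> k)"

text \<open>A pair \<open>(l, r) \<in> R\<close> is the defining relation \<open>l = r\<close>.\<close>

inductive word_eq :: "('g word \<times> 'g word) set \<Rightarrow> 'g word \<Rightarrow> 'g word \<Rightarrow> bool"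
  for R :: "('g word \<times> 'g word) set" where
  refl: "word_eq R u u"
| sym: "word_eq R u v \<Longrightarrow> word_eq R v u"
| trans: "word_eq R u v \<Longrightarrow> word_eq R v w \<Longrightarrow> word_eq R u w"
| cancel: "word_eq R (u @ [x, inv_letter x] @ v) (u @ v)"
| relation: "(l, r) \<in> R \<Longrightarrow> word_eq R (u @ l @ v) (u @ r @ v)"

definition elt :: "('g word \<times> 'g word) set \<Rightarrow> 'g word \<Rightarrow> 'g word set" where
  "elt R u = {v. word_eq R u v}"

definition presented_group :: "('g word \<times> 'g word) set \<Rightarrow> 'g word set monoid" where
  "presented_group R =
     \<lparr>carrier = range (elt R),
      mult = (\<lambda>A B. \<Union>u\<in>A. \<Union>v\<in>B. elt R (u @ v)),
      one = elt R []\<rparr>"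

lemma carrier_presented_group [simp]: "carrier (presented_group R) = range (elt R)"
  and one_presented_group: "\<one>\<^bsub>presented_group R\<^esub> = elt R []"
  by (simp_all add: presented_group_def)

lemma elt_eq_iff: "elt R u = elt R v \<longleftrightarrow> word_eq R u v"
  unfolding elt_def set_eq_iff mem_Collect_eq
  by (meson word_eq.refl word_eq.sym word_eq.trans)

lemma word_eq_append_left: "word_eq R u v \<Longrightarrow> word_eq R (w @ u) (w @ v)"
proof (induction rule: word_eq.induct)
  case (cancel u x v)
  then show ?case using word_eq.cancel[of R "w @ u" x v] by simp
next
  case (relation l r u v)
  then show ?case using word_eq.relation[of l r R "w @ u" v] by simp
qed (rule word_eq.refl, erule word_eq.sym, erule (1) word_eq.trans)

lemma word_eq_append_right: "word_eq R u v \<Longrightarrow> word_eq R (u @ w) (v @ w)"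
proof (induction rule: word_eq.induct)
  case (cancel u x v)
  then show ?case using word_eq.cancel[of R u x "v @ w"] by simp
next
  case (relation l r u v)
  then show ?case using word_eq.relation[of l r R u "v @ w"] by simp
qed (rule word_eq.refl, erule word_eq.sym, erule (1) word_eq.trans)

lemma word_eq_append:
  "word_eq R u u' \<Longrightarrow> word_eq R v v' \<Longrightarrow> word_eq R (u @ v) (u' @ v')"
  by (meson word_eq.trans word_eq_append_left word_eq_append_right)

lemma elt_mult [simp]:
  "elt R u \<otimes>\<^bsub>presented_group R\<^esub> elt R v = elt R (u @ v)"
proof -
  have "elt R (u' @ v') = elt R (u @ v)" if "u' \<in> elt R u" "v' \<in> elt R v" for u' v'
    using that word_eq.sym[OF word_eq_append] unfolding elt_eq_iff by (simp add: elt_def)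
  moreover have "u \<in> elt R u" "v \<in> elt R v"
    by (simp_all add: elt_def word_eq.refl)
  ultimately have "(\<Union>u'\<in>elt R u. \<Union>v'\<in>elt R v. elt R (u' @ v')) = elt R (u @ v)"
    by blast
  then show ?thesis
    by (simp add: presented_group_def)
qed

lemma word_eq_inv_left: "word_eq R (rev (map inv_letter u) @ u) []"
proof (induction u)
  case Nil
  show ?case by (simp add: word_eq.refl)
next
  case (Cons x u)
  have "word_eq R (rev (map inv_letter u) @ [inv_letter x, inv_letter (inv_letter x)] @ u)
          (rev (map inv_letter u) @ u)"
    by (rule word_eq.cancel)
  moreover have "inv_letter (inv_letter x) = x"
    by (simp add: inv_letter_def)
  ultimately have "word_eq R (rev (map inv_letter (x # u)) @ x # u) (rev (map inv_letter u) @ u)"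
    by simp
  then show ?case
    using Cons.IH by (rule word_eq.trans)
qed

lemma group_presented_group: "group (presented_group R)"
proof (rule groupI)
  fix x assume "x \<in> carrier (presented_group R)"
  then obtain u where u: "x = elt R u"
    by auto
  have "elt R (rev (map inv_letter u)) \<otimes>\<^bsub>presented_group R\<^esub> x = \<one>\<^bsub>presented_group R\<^esub>"
    using word_eq_inv_left[of R u] by (simp add: u elt_eq_iff one_presented_group)
  then show "\<exists>y\<in>carrier (presented_group R). y \<otimes>\<^bsub>presented_group R\<^esub> x = \<one>\<^bsub>presented_group R\<^esub>"
    by auto
qed (auto simp: one_presented_group)

datatype bs_gen = gen_a | gen_t

definition BS1_rels :: "int \<Rightarrow> (bs_gen word \<times> bs_gen word) set" where
  "BS1_rels n = {([(gen_t, False)] @ gen_pow gen_a n @ [(gen_t, True)], [(gen_a, True)])}"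

definition BS1 :: "int \<Rightarrow> bs_gen word set monoid" where
  "BS1 n = presented_group (BS1_rels n)"

abbreviation BS1_elt :: "int \<Rightarrow> bs_gen word \<Rightarrow> bs_gen word set" where
  "BS1_elt n \<equiv> elt (BS1_rels n)"

definition twisted_conjugate ::
  "('a, 'b) monoid_scheme \<Rightarrow> ('a \<Rightarrow> 'a) \<Rightarrow> 'a \<Rightarrow> 'a \<Rightarrow> bool" where
  "twisted_conjugate G \<phi> u v \<longleftrightarrow>
     (\<exists>x\<in>carrier G. v = inv\<^bsub>G\<^esub> (\<phi> x) \<otimes>\<^bsub>G\<^esub> u \<otimes>\<^bsub>G\<^esub> x)"

text \<open>
  Kleene's partial recursive functions, as programs with a big-step semantics:
  \<open>recf_eval f xs y\<close> says that \<open>f\<close> halts on the argument list \<open>xs\<close> with output \<open>y\<close>. The recursion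
  argument of \<open>PrimRec\<close> and the search argument of \<open>Mu\<close> come first. Arities are not part of
  the syntax: surplus arguments are ignored, and a basic function that lacks an argument it
  reads has no value.
\<close>

datatype recf =
    Zero
  | Succ
  | Proj nat
  | Comp recf "recf list"
  | PrimRec recf recf
  | Mu recf

inductive recf_eval :: "recf \<Rightarrow> nat list \<Rightarrow> nat \<Rightarrow> bool" where
  Zero: "recf_eval Zero xs 0"
| Succ: "recf_eval Succ (x # xs) (Suc x)"
| Proj: "i < length xs \<Longrightarrow> recf_eval (Proj i) xs (xs ! i)"
| Comp: "list_all2 (\<lambda>g y. recf_eval g xs y) gs ys \<Longrightarrow> recf_eval f ys z
    \<Longrightarrow> recf_eval (Comp f gs) xs z"
| PrimRec_0: "recf_eval f xs y \<Longrightarrow> recf_eval (PrimRec f g) (0 # xs) y"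
| PrimRec_Suc: "recf_eval (PrimRec f g) (k # xs) y \<Longrightarrow> recf_eval g (k # y # xs) z
    \<Longrightarrow> recf_eval (PrimRec f g) (Suc k # xs) z"
| Mu: "recf_eval f (k # xs) 0 \<Longrightarrow> \<forall>i<k. \<exists>y. recf_eval f (i # xs) (Suc y)
    \<Longrightarrow> recf_eval (Mu f) xs k"

inductive_cases recf_eval_ZeroE: "recf_eval Zero xs y"
inductive_cases recf_eval_SuccE: "recf_eval Succ xs y"
inductive_cases recf_eval_ProjE: "recf_eval (Proj i) xs y"
inductive_cases recf_eval_CompE: "recf_eval (Comp f gs) xs y"
inductive_cases recf_eval_PrimRec0E: "recf_eval (PrimRec f g) (0 # xs) y"
inductive_cases recf_eval_PrimRecSucE: "recf_eval (PrimRec f g) (Suc k # xs) y"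
inductive_cases recf_eval_MuE: "recf_eval (Mu f) xs y"

lemma recf_eval_deterministic:
  "recf_eval f xs y \<Longrightarrow> recf_eval f xs y' \<Longrightarrow> y' = y"
proof (induction arbitrary: y' rule: recf_eval.induct)
  case (Zero xs)
  then show ?case by (rule recf_eval_ZeroE)
next
  case (Succ x xs)
  then show ?case by (rule recf_eval_SuccE) simp
next
  case (Proj i xs)
  from Proj.prems show ?case by (rule recf_eval_ProjE)
next
  case (Comp xs gs ys f z)
  from Comp.prems obtain ys' where
    ys': "list_all2 (\<lambda>g y. recf_eval g xs y) gs ys'" "recf_eval f ys' y'"
    by (rule recf_eval_CompE)
  have IH: "length gs = length ys"
    "\<forall>i<length gs. recf_eval (gs ! i) xs (ys ! i) \<and> (\<forall>y'. recf_eval (gs ! i) xs y' \<longrightarrow> y' = ys ! i)"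
    using Comp.IH(1) unfolding list_all2_conv_all_nth by blast+
  have len: "length gs = length ys'"
    and val: "\<forall>i<length gs. recf_eval (gs ! i) xs (ys' ! i)"
    using ys'(1) unfolding list_all2_conv_all_nth by blast+
  have "ys' = ys"
  proof (rule nth_equalityI)
    show "length ys' = length ys"
      using IH(1) len by argo
    show "ys' ! i = ys ! i" if "i < length ys'" for i
      using that IH(2) val unfolding len by blast
  qed
  then show ?case using Comp.IH(2) ys'(2) by blast
next
  case (PrimRec_0 f xs y g)
  from PrimRec_0.prems have "recf_eval f xs y'" by (rule recf_eval_PrimRec0E)
  then show ?case by (rule PrimRec_0.IH)
next
  case (PrimRec_Suc f g k xs y z)
  from PrimRec_Suc.prems obtain w where
    w: "recf_eval (PrimRec f g) (k # xs) w" "recf_eval g (k # w # xs) y'"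
    by (rule recf_eval_PrimRecSucE)
  from w(2) show ?case
    unfolding PrimRec_Suc.IH(1)[OF w(1)] by (rule PrimRec_Suc.IH(2))
next
  case (Mu f k xs)
  from Mu.prems have *: "recf_eval f (y' # xs) 0"
    "\<forall>i<y'. \<exists>y. recf_eval f (i # xs) (Suc y)"
    by - (erule recf_eval_MuE, assumption)+
  have "\<not> y' < k"
    using Mu.IH(2) *(1) nat.distinct(1) by blast
  moreover have "\<not> k < y'"
    using Mu.IH(1) *(2) nat.distinct(1) by blast
  ultimately show ?case by linarith
qed

text \<open>The alphabet is numbered \<open>a, a\<^sup>-\<^sup>1, t, t\<^sup>-\<^sup>1\<close>.\<close>

fun letter_code :: "bs_gen \<times> bool \<Rightarrow> nat" where
  "letter_code (gen_a, True) = 0"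
| "letter_code (gen_a, False) = 1"
| "letter_code (gen_t, True) = 2"
| "letter_code (gen_t, False) = 3"

definition word_code :: "bs_gen word \<Rightarrow> nat" where
  "word_code w = list_encode (map letter_code w)"

end

theory Submission
  imports Defs Complex_Main
begin

text \<open>
  For \<open>n \<noteq> 0\<close> the group is the affine group \<open>\<int>[1/n] \<rtimes> \<int>\<close>, and both coordinates of an element
  can be computed from any word for it. If moreover \<open>n \<noteq> 1\<close>, an injective endomorphism \<open>\<phi>\<close> sends \<open>a\<close> to a
  translation and \<open>t\<close> to an element of \<open>t\<close>-exponent \<open>\<epsilon>\<close> with \<open>n\<^bsup>\<epsilon>\<^esup> = n\<close>, so twisted conjugacy becomes
  the solvability of \<open>(\<epsilon> - 1) m = d\<close> and \<open>A z = X - n\<^bsup>m\<^esup> Y\<close> in \<open>m \<in> \<int>\<close>, \<open>z \<in> \<int>[1/n]\<close>. After clearing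
  denominators this reads \<open>A dvd n\<^bsup>i\<^esup> X - n\<^bsup>j\<^esup> Y\<close> with \<open>m = j - i\<close>, and small exponents suffice: for
  \<open>A \<noteq> 0\<close> because powers of \<open>n\<close> are eventually periodic modulo \<open>A\<close>, for \<open>A = 0\<close> by growth. For \<open>n = 1\<close>
  the group is \<open>\<int>\<^sup>2\<close> and one has to solve two linear equations over \<open>\<int>\<close>; for \<open>n = 0\<close> it is \<open>\<int>\<close>, generated
  by \<open>t\<close>.
\<close>

section \<open>Computable functions\<close>

text \<open>Only lists of length \<open>k\<close> are constrained, so a function may be changed
  freely on all other lists.\<close>

definition computable :: "nat \<Rightarrow> (nat list \<Rightarrow> nat) \<Rightarrow> bool" where
  "computable k f \<longleftrightarrow> (\<exists>r. \<forall>xs. length xs = k \<longrightarrow> recf_eval r xs (f xs))"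

named_theorems computable_intros

lemma computable_cong:
  assumes "computable k f" "\<And>xs. length xs = k \<Longrightarrow> f xs = g xs"
  shows "computable k g"
  using assms unfolding computable_def by metis

lemma computable_nth [computable_intros]: "i < k \<Longrightarrow> computable k (\<lambda>xs. xs ! i)"
  unfolding computable_def by (metis recf_eval.Proj)

lemma computable_comp:
  assumes f: "computable (length gs) f" and gs: "\<And>g. g \<in> set gs \<Longrightarrow> computable k g"
  shows "computable k (\<lambda>xs. f (map (\<lambda>g. g xs) gs))"
proof -
  obtain r where r: "\<And>xs. length xs = length gs \<Longrightarrow> recf_eval r xs (f xs)"
    using f unfolding computable_def by blast
  obtain s where s: "\<And>g xs. g \<in> set gs \<Longrightarrow> length xs = k \<Longrightarrow> recf_eval (s g) xs (g xs)"
    using gs unfolding computable_def by metis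
  have "recf_eval (Comp r (map s gs)) xs (f (map (\<lambda>g. g xs) gs))" if "length xs = k" for xs
    by (rule recf_eval.Comp[where ys = "map (\<lambda>g. g xs) gs"])
      (use that r s in \<open>auto simp: list_all2_map1 list_all2_map2 list_all2_same\<close>)
  then show ?thesis
    unfolding computable_def by blast
qed

lemma computable_comp1:
  assumes "computable 1 (\<lambda>xs. F (xs ! 0))" "computable k f"
  shows "computable k (\<lambda>xs. F (f xs))"
  using computable_comp[of "[f]" "\<lambda>xs. F (xs ! 0)"] assms by simp

lemma computable_Suc [computable_intros]:
  assumes "computable k f"
  shows "computable k (\<lambda>xs. Suc (f xs))"
proof (rule computable_comp1[OF _ assms])
  have "recf_eval Succ xs (Suc (xs ! 0))" if "length xs = 1" for xs
    using that by (cases xs) (auto intro: recf_eval.Succ)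
  then show "computable 1 (\<lambda>xs. Suc (xs ! 0))"
    unfolding computable_def by blast
qed

lemma computable_const [computable_intros]: "computable k (\<lambda>_. c)"
proof (induction c)
  case 0
  then show ?case unfolding computable_def by (metis recf_eval.Zero)
qed (rule computable_Suc)

text \<open>Composition with the projections from \<open>m\<close> to \<open>m + k - 1\<close>. It
  lets a function ignore variables that a recursion or a binder puts in front.\<close>

lemma computable_drop:
  assumes "computable k f"
  shows "computable (m + k) (\<lambda>xs. f (drop m xs))"
proof -
  have "computable (m + k) (\<lambda>xs. f (map (\<lambda>g. g xs) (map (\<lambda>i xs. xs ! i) [m..<m + k])))"
    by (rule computable_comp) (auto simp: assms intro: computable_nth)
  then show ?thesis
  proof (rule computable_cong)
    fix xs :: "nat list"
    assume "length xs = m + k"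
    then have "map (\<lambda>g. g xs) (map (\<lambda>i xs. xs ! i) [m..<m + k]) = drop m xs"
      by (intro nth_equalityI) auto
    then show "f (map (\<lambda>g. g xs) (map (\<lambda>i xs. xs ! i) [m..<m + k])) = f (drop m xs)"
      by (rule arg_cong)
  qed
qed

lemma computable_tl: "computable k f \<Longrightarrow> computable (Suc k) (\<lambda>xs. f (tl xs))"
  using computable_drop[of k f 1] by (simp add: drop_Suc)

lemma computable_nth_tl [computable_intros]:
  "i < k \<Longrightarrow> computable (Suc k) (\<lambda>xs. tl xs ! i)"
  by (intro computable_tl computable_nth)

text \<open>\<open>PrimRec\<close> recurses on its first argument, so the recursion is first carried
  out with its length as an extra leading argument. Composition with \<open>e\<close> followed by
  all projections then puts the value of \<open>e\<close> there.\<close>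

lemma computable_rec_nat:
  assumes b: "computable k b"
    and h: "computable (Suc (Suc k)) (\<lambda>ys. h (ys ! 0) (ys ! 1) (tl (tl ys)))"
    and e: "computable k e"
  shows "computable k (\<lambda>xs. rec_nat (b xs) (\<lambda>i y. h i y xs) (e xs))"
proof -
  obtain rb where rb: "\<And>xs. length xs = k \<Longrightarrow> recf_eval rb xs (b xs)"
    using b unfolding computable_def by blast
  obtain rh where rh: "\<And>i y xs. length xs = k \<Longrightarrow> recf_eval rh (i # y # xs) (h i y xs)"
    using h unfolding computable_def
    by (metis length_Cons list.sel(3) nth_Cons_0 nth_Cons_Suc One_nat_def)
  have "recf_eval (PrimRec rb rh) (i # xs) (rec_nat (b xs) (\<lambda>i y. h i y xs) i)"
    if "length xs = k" for i xs
    by (induction i) (auto intro: recf_eval.PrimRec_0 recf_eval.PrimRec_Suc rb rh that)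
  then have "recf_eval (PrimRec rb rh) xs (rec_nat (b (tl xs)) (\<lambda>i y. h i y (tl xs)) (xs ! 0))"
    if "length xs = Suc k" for xs
    using that by (cases xs) auto
  then have "computable (Suc k) (\<lambda>xs. rec_nat (b (tl xs)) (\<lambda>i y. h i y (tl xs)) (xs ! 0))"
    unfolding computable_def by blast
  moreover have "computable k g" if "g \<in> set (e # map (\<lambda>i xs. xs ! i) [0..<k])" for g
    using that e by (auto intro: computable_nth)
  ultimately have "computable k (\<lambda>xs. rec_nat
      (b (tl (map (\<lambda>g. g xs) (e # map (\<lambda>i xs. xs ! i) [0..<k]))))
      (\<lambda>i y. h i y (tl (map (\<lambda>g. g xs) (e # map (\<lambda>i xs. xs ! i) [0..<k]))))
      ((map (\<lambda>g. g xs) (e # map (\<lambda>i xs. xs ! i) [0..<k])) ! 0))"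
    by (intro computable_comp) simp_all
  then show ?thesis
  proof (rule computable_cong)
    fix xs :: "nat list"
    assume "length xs = k"
    then have "map (\<lambda>g. g xs) (map (\<lambda>i xs. xs ! i) [0..<k]) = xs"
      by (intro nth_equalityI) auto
    then show "rec_nat
      (b (tl (map (\<lambda>g. g xs) (e # map (\<lambda>i xs. xs ! i) [0..<k]))))
      (\<lambda>i y. h i y (tl (map (\<lambda>g. g xs) (e # map (\<lambda>i xs. xs ! i) [0..<k]))))
      ((map (\<lambda>g. g xs) (e # map (\<lambda>i xs. xs ! i) [0..<k])) ! 0)
      = rec_nat (b xs) (\<lambda>i y. h i y xs) (e xs)"
      by simp
  qed
qed

lemma computable_add [computable_intros]:
  assumes "computable k f" "computable k g"
  shows "computable k (\<lambda>xs. f xs + g xs)"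
proof (rule computable_cong)
  show "computable k (\<lambda>xs. rec_nat (f xs) (\<lambda>i y. Suc y) (g xs))"
    by (intro computable_rec_nat computable_intros assms
        assms[THEN computable_tl, THEN computable_tl]) simp
  have "rec_nat a (\<lambda>i y. Suc y) b = a + b" for a b :: nat
    by (induction b) auto
  then show "rec_nat (f xs) (\<lambda>i y. Suc y) (g xs) = f xs + g xs" for xs .
qed

lemma computable_mult [computable_intros]:
  assumes "computable k f" "computable k g"
  shows "computable k (\<lambda>xs. f xs * g xs)"
proof (rule computable_cong)
  show "computable k (\<lambda>xs. rec_nat 0 (\<lambda>i y. y + f xs) (g xs))"
    by (intro computable_rec_nat computable_intros assms
        assms[THEN computable_tl, THEN computable_tl]) simp
  have "rec_nat 0 (\<lambda>i y. y + a) b = a * b" for a b :: nat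
    by (induction b) auto
  then show "rec_nat 0 (\<lambda>i y. y + f xs) (g xs) = f xs * g xs" for xs .
qed

lemma computable_diff [computable_intros]:
  assumes "computable k f" "computable k g"
  shows "computable k (\<lambda>xs. f xs - g xs)"
proof (rule computable_cong)
  have pred: "computable k (\<lambda>xs. f xs - 1)" if "computable k f" for k f
  proof (rule computable_cong)
    show "computable k (\<lambda>xs. rec_nat 0 (\<lambda>i y. i) (f xs))"
      by (intro computable_rec_nat computable_intros that) simp
    show "rec_nat 0 (\<lambda>i y. i) (f xs) = f xs - 1" for xs
      by (cases "f xs") auto
  qed
  show "computable k (\<lambda>xs. rec_nat (f xs) (\<lambda>i y. y - 1) (g xs))"
    by (intro computable_rec_nat pred computable_intros assms) simp
  have "rec_nat a (\<lambda>i y. y - 1) b = a - b" for a b :: nat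
    by (induction b) auto
  then show "rec_nat (f xs) (\<lambda>i y. y - 1) (g xs) = f xs - g xs" for xs .
qed

lemma computable_power [computable_intros]:
  assumes "computable k f" "computable k g"
  shows "computable k (\<lambda>xs. f xs ^ g xs)"
proof (rule computable_cong)
  show "computable k (\<lambda>xs. rec_nat 1 (\<lambda>i y. y * f xs) (g xs))"
    by (intro computable_rec_nat computable_intros assms
        assms[THEN computable_tl, THEN computable_tl]) simp
  have "rec_nat 1 (\<lambda>i y. y * a) b = a ^ b" for a b :: nat
    by (induction b) auto
  then show "rec_nat 1 (\<lambda>i y. y * f xs) (g xs) = f xs ^ g xs" for xs .
qed

text \<open>
  Under a binder the bound variable is pushed in front of the arguments, so that inside it they
  appear as \<open>tl ys\<close>.
\<close>

lemma computable_sum [computable_intros]: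
  assumes "computable (Suc k) (\<lambda>ys. h (ys ! 0) (tl ys))" "computable k e"
  shows "computable k (\<lambda>xs. \<Sum>i<e xs. h i xs)"
proof (rule computable_cong)
  \<comment> \<open>During the recursion the list holds index, accumulator, parameters; the summand
    has to skip the accumulator.\<close>
  have "computable (Suc (Suc k)) (\<lambda>ys. h (ys ! 0) (tl (tl ys)))"
  proof (rule computable_cong)
    show "computable (Suc (Suc k)) (\<lambda>ys. (\<lambda>ys. h (ys ! 0) (tl ys))
        (map (\<lambda>g. g ys) ((\<lambda>ys. ys ! 0) # map (\<lambda>i ys. ys ! i) [2..<Suc (Suc k)])))"
      by (rule computable_comp) (auto simp: assms(1) numeral_2_eq_2 simp del: upt_Suc intro: computable_nth)
    fix ys :: "nat list"
    assume "length ys = Suc (Suc k)"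
    then have "map (\<lambda>g. g ys) (map (\<lambda>i ys. ys ! i) [2..<Suc (Suc k)]) = tl (tl ys)"
      by (intro nth_equalityI) (auto simp: nth_tl simp del: upt_Suc)
    then show "(\<lambda>ys. h (ys ! 0) (tl ys))
        (map (\<lambda>g. g ys) ((\<lambda>ys. ys ! 0) # map (\<lambda>i ys. ys ! i) [2..<Suc (Suc k)]))
      = h (ys ! 0) (tl (tl ys))"
      by simp
  qed
  then show "computable k (\<lambda>xs. rec_nat 0 (\<lambda>i y. y + h i xs) (e xs))"
    by (intro computable_rec_nat computable_intros assms(2)) simp_all
  have "rec_nat 0 (\<lambda>i y. y + g i) b = (\<Sum>i<b. g i)" for g :: "nat \<Rightarrow> nat" and b
    by (induction b) auto
  then show "rec_nat 0 (\<lambda>i y. y + h i xs) (e xs) = (\<Sum>i<e xs. h i xs)" for xs .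
qed

section \<open>Decidable predicates and bounded quantifiers\<close>

definition decidable :: "nat \<Rightarrow> (nat list \<Rightarrow> bool) \<Rightarrow> bool" where
  "decidable k P \<longleftrightarrow> computable k (\<lambda>xs. of_bool (P xs))"

lemma computable_of_bool [computable_intros]:
  "decidable k P \<Longrightarrow> computable k (\<lambda>xs. of_bool (P xs))"
  by (simp add: decidable_def)

lemma decidable_cong:
  assumes "decidable k P" "\<And>xs. length xs = k \<Longrightarrow> P xs = Q xs"
  shows "decidable k Q"
  using assms(1) unfolding decidable_def by (rule computable_cong) (simp add: assms(2))

lemma decidable_not [computable_intros]:
  assumes "decidable k P"
  shows "decidable k (\<lambda>xs. \<not> P xs)"
  unfolding decidable_def
  by (rule computable_cong[of _ "\<lambda>xs. 1 - of_bool (P xs)"]) (auto intro!: computable_intros assms)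

lemma decidable_conj [computable_intros]:
  assumes "decidable k P" "decidable k Q"
  shows "decidable k (\<lambda>xs. P xs \<and> Q xs)"
  unfolding decidable_def
  by (rule computable_cong[of _ "\<lambda>xs. of_bool (P xs) * of_bool (Q xs)"])
    (auto intro!: computable_intros assms)

lemma decidable_disj [computable_intros]:
  assumes "decidable k P" "decidable k Q"
  shows "decidable k (\<lambda>xs. P xs \<or> Q xs)"
  using decidable_not[OF decidable_conj[OF assms[THEN decidable_not]]] by simp

lemma decidable_imp [computable_intros]:
  assumes "decidable k P" "decidable k Q"
  shows "decidable k (\<lambda>xs. P xs \<longrightarrow> Q xs)"
  using decidable_disj[OF decidable_not[OF assms(1)] assms(2)] by simp

lemma decidable_eq [computable_intros]:
  assumes "computable k f" "computable k g"
  shows "decidable k (\<lambda>xs. f xs = g xs)"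
  unfolding decidable_def
  by (rule computable_cong[of _ "\<lambda>xs. 1 - ((f xs - g xs) + (g xs - f xs))"])
    (auto intro!: computable_intros assms)

lemma decidable_bex [computable_intros]:
  assumes "decidable (Suc k) (\<lambda>ys. P (ys ! 0) (tl ys))" "computable k e"
  shows "decidable k (\<lambda>xs. \<exists>i<e xs. P i xs)"
proof (rule decidable_cong)
  show "decidable k (\<lambda>xs. \<not> (\<Sum>i<e xs. of_bool (P i xs)) = (0::nat))"
    by (intro computable_intros assms)
  show "(\<not> (\<Sum>i<e xs. of_bool (P i xs)) = (0::nat)) = (\<exists>i<e xs. P i xs)" for xs
    by (auto simp: sum_eq_0_iff)
qed

lemma decidable_ball [computable_intros]:
  assumes "decidable (Suc k) (\<lambda>ys. P (ys ! 0) (tl ys))" "computable k e"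
  shows "decidable k (\<lambda>xs. \<forall>i<e xs. P i xs)"
  using decidable_not[OF decidable_bex[where P = "\<lambda>i xs. \<not> P i xs", OF decidable_not[OF assms(1)] assms(2)]]
  by simp

lemma computable_if [computable_intros]:
  assumes "decidable k P" "computable k f" "computable k g"
  shows "computable k (\<lambda>xs. if P xs then f xs else g xs)"
  by (rule computable_cong[of _ "\<lambda>xs. of_bool (P xs) * f xs + of_bool (\<not> P xs) * g xs"])
    (auto intro!: computable_intros assms)

lemma decidable_dvd [computable_intros]:
  assumes "computable k f" "computable k g"
  shows "decidable k (\<lambda>xs. f xs dvd g xs)"
proof (rule decidable_cong)
  \<comment> \<open>If \<open>f xs\<close> is nonzero, a cofactor of \<open>g xs\<close> is at most
    \<open>g xs\<close>; if \<open>f xs = 0\<close>, divisibility means \<open>g xs = 0\<close> and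
    the cofactor 0 will do.\<close>
  show "decidable k (\<lambda>xs. \<exists>i<Suc (g xs). g xs = f xs * i)"
    by (intro computable_intros assms assms[THEN computable_tl]) simp
  show "(\<exists>i<Suc (g xs). g xs = f xs * i) = (f xs dvd g xs)" for xs
    by (cases "f xs = 0") (auto simp: dvd_def less_Suc_eq_le)
qed

text \<open>Two naturals stand for their difference. The pair is not unique, but sums and products
  then need no case distinction on signs.\<close>

definition int_computable :: "nat \<Rightarrow> (nat list \<Rightarrow> int) \<Rightarrow> bool" where
  "int_computable k f \<longleftrightarrow> (\<exists>g h. computable k g \<and> computable k h \<and>
     (\<forall>xs. length xs = k \<longrightarrow> f xs = int (g xs) - int (h xs)))"

lemma int_computableI:
  assumes "computable k g" "computable k h" "\<And>xs. length xs = k \<Longrightarrow> f xs = int (g xs) - int (h xs)"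
  shows "int_computable k f"
  using assms unfolding int_computable_def by blast

lemma int_computableE:
  assumes "int_computable k f"
  obtains g h where "computable k g" "computable k h"
    "\<And>xs. length xs = k \<Longrightarrow> f xs = int (g xs) - int (h xs)"
  using assms unfolding int_computable_def by blast

lemma int_computable_cong:
  assumes "int_computable k f" "\<And>xs. length xs = k \<Longrightarrow> f xs = g xs"
  shows "int_computable k g"
  using assms unfolding int_computable_def by auto

lemma int_computable_int [computable_intros]:
  "computable k f \<Longrightarrow> int_computable k (\<lambda>xs. int (f xs))"
  by (rule int_computableI[of _ f "\<lambda>_. 0"]) (auto intro: computable_intros)

lemma int_computable_tl:
  assumes "int_computable k f"
  shows "int_computable (Suc k) (\<lambda>xs. f (tl xs))"
  using assms
proof (rule int_computableE)
  fix g h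
  assume "computable k g" "computable k h" "\<And>xs. length xs = k \<Longrightarrow> f xs = int (g xs) - int (h xs)"
  then show ?thesis
    by (intro int_computableI[of _ "\<lambda>xs. g (tl xs)" "\<lambda>xs. h (tl xs)"] computable_tl) auto
qed

lemma int_computable_const [computable_intros]: "int_computable k (\<lambda>_. c)"
  by (rule int_computableI[of _ "\<lambda>_. nat c" "\<lambda>_. nat (- c)"]) (auto intro: computable_intros)

lemma int_computable_add [computable_intros]:
  assumes "int_computable k f" "int_computable k g"
  shows "int_computable k (\<lambda>xs. f xs + g xs)"
proof -
  obtain a b c d where "computable k a" "computable k b" "computable k c" "computable k d"
    "\<And>xs. length xs = k \<Longrightarrow> f xs = int (a xs) - int (b xs)"
    "\<And>xs. length xs = k \<Longrightarrow> g xs = int (c xs) - int (d xs)"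
    using assms by (elim int_computableE) blast
  then show ?thesis
    by (intro int_computableI[of _ "\<lambda>xs. a xs + c xs" "\<lambda>xs. b xs + d xs"] computable_intros) auto
qed

lemma int_computable_mult [computable_intros]:
  assumes "int_computable k f" "int_computable k g"
  shows "int_computable k (\<lambda>xs. f xs * g xs)"
proof -
  obtain a b c d where "computable k a" "computable k b" "computable k c" "computable k d"
    "\<And>xs. length xs = k \<Longrightarrow> f xs = int (a xs) - int (b xs)"
    "\<And>xs. length xs = k \<Longrightarrow> g xs = int (c xs) - int (d xs)"
    using assms by (elim int_computableE) blast
  moreover have "(int a - int b) * (int c - int d) = int (a * c + b * d) - int (a * d + b * c)"
    for a b c d
    by (simp add: algebra_simps)
  ultimately show ?thesis
    by (intro int_computableI[of _ "\<lambda>xs. a xs * c xs + b xs * d xs" "\<lambda>xs. a xs * d xs + b xs * c xs"]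
        computable_intros) auto
qed

lemma int_computable_diff [computable_intros]:
  assumes "int_computable k f" "int_computable k g"
  shows "int_computable k (\<lambda>xs. f xs - g xs)"
proof -
  have "int_computable k (\<lambda>xs. f xs + (- 1) * g xs)"
    by (intro computable_intros assms)
  then show ?thesis by simp
qed

lemma int_computable_power [computable_intros]:
  assumes "computable k e"
  shows "int_computable k (\<lambda>xs. n ^ e xs)"
proof (rule int_computable_cong)
  \<comment> \<open>The inner recursion runs through 0, 1, 0, 1, ... and so yields the parity of the
    exponent, which decides the sign when the constant base is negative.\<close>
  show "int_computable k (\<lambda>xs. int (nat \<bar>n\<bar> ^ e xs) *
      (1 - 2 * of_bool (\<not> 0 \<le> n) * int (rec_nat 0 (\<lambda>_ y. 1 - y) (e xs))))"
    by (intro computable_intros computable_rec_nat assms) simp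
  have "int (nat \<bar>n\<bar> ^ m) * (1 - 2 * of_bool (\<not> 0 \<le> n) * int (rec_nat 0 (\<lambda>_ y. 1 - y) m)) = n ^ m" for m
  proof -
    have r: "rec_nat 0 (\<lambda>_ y. 1 - y) m = (of_bool (odd m) :: nat)"
      by (induction m) auto
    show ?thesis
      unfolding r using power_minus[of "-n" m] by (cases "0 \<le> n"; cases "odd m") auto
  qed
  then show "int (nat \<bar>n\<bar> ^ e xs) *
      (1 - 2 * of_bool (\<not> 0 \<le> n) * int (rec_nat 0 (\<lambda>_ y. 1 - y) (e xs))) = n ^ e xs" for xs .
qed

lemma int_computable_sum [computable_intros]:
  assumes "int_computable (Suc k) (\<lambda>ys. f (ys ! 0) (tl ys))" "computable k e"
  shows "int_computable k (\<lambda>xs. \<Sum>i<e xs. f i xs)"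
proof -
  obtain g h where gh: "computable (Suc k) g" "computable (Suc k) h"
    "\<And>ys. length ys = Suc k \<Longrightarrow> f (ys ! 0) (tl ys) = int (g ys) - int (h ys)"
    using assms(1) by (elim int_computableE) blast
  have hd_tl: "computable (Suc k) (\<lambda>ys. g (ys ! 0 # tl ys))" if "computable (Suc k) g" for g
    using that
  proof (rule computable_cong)
    show "g ys = g (ys ! 0 # tl ys)" if "length ys = Suc k" for ys
      using that by (cases ys) auto
  qed
  show ?thesis
  proof (rule int_computableI)
    show "computable k (\<lambda>xs. \<Sum>i<e xs. g (i # xs))" "computable k (\<lambda>xs. \<Sum>i<e xs. h (i # xs))"
      by (intro computable_sum hd_tl gh assms)+
    show "(\<Sum>i<e xs. f i xs) = int (\<Sum>i<e xs. g (i # xs)) - int (\<Sum>i<e xs. h (i # xs))"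
      if "length xs = k" for xs
      using gh(3)[of "_ # xs"] that by (simp add: sum_subtractf)
  qed
qed

lemma computable_nat_abs [computable_intros]:
  assumes "int_computable k f"
  shows "computable k (\<lambda>xs. nat \<bar>f xs\<bar>)"
proof -
  obtain g h where gh: "computable k g" "computable k h"
    "\<And>xs. length xs = k \<Longrightarrow> f xs = int (g xs) - int (h xs)"
    using assms by (elim int_computableE) blast
  show ?thesis
  proof (rule computable_cong)
    show "computable k (\<lambda>xs. (g xs - h xs) + (h xs - g xs))"
      by (intro computable_intros gh)
    show "(g xs - h xs) + (h xs - g xs) = nat \<bar>f xs\<bar>" if "length xs = k" for xs
      unfolding gh(3)[OF that] by linarith
  qed
qed

lemma decidable_int_eq [computable_intros]:
  assumes "int_computable k f" "int_computable k g"
  shows "decidable k (\<lambda>xs. f xs = g xs)"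
proof (rule decidable_cong)
  show "decidable k (\<lambda>xs. nat \<bar>f xs - g xs\<bar> = 0)"
    by (intro computable_intros assms)
qed auto

lemma decidable_int_dvd [computable_intros]:
  assumes "int_computable k f" "int_computable k g"
  shows "decidable k (\<lambda>xs. f xs dvd g xs)"
proof (rule decidable_cong)
  show "decidable k (\<lambda>xs. nat \<bar>f xs\<bar> dvd nat \<bar>g xs\<bar>)"
    by (intro computable_intros assms)
qed simp

text \<open>
  On list codes, \<open>hd_code\<close> and \<open>tl_code\<close> are head and tail; the value \<open>4\<close>, which is no letter
  code, marks the empty list.
\<close>

definition hd_code :: "nat \<Rightarrow> nat" where
  "hd_code c = (if c = 0 then 4 else fst (prod_decode (c - 1)))"

definition tl_code :: "nat \<Rightarrow> nat" where
  "tl_code c = (if c = 0 then 0 else snd (prod_decode (c - 1)))"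

section \<open>Cantor pairing and list codes\<close>

lemma computable_prod_encode [computable_intros]:
  assumes "computable k f" "computable k g"
  shows "computable k (\<lambda>xs. prod_encode (f xs, g xs))"
proof (rule computable_cong)
  show "computable k (\<lambda>xs. (\<Sum>i<Suc (f xs + g xs). i) + f xs)"
    by (intro computable_intros assms) simp
  have "(\<Sum>i<Suc m. i) = triangle m" for m
    by (induction m) auto
  then show "(\<Sum>i<Suc (f xs + g xs). i) + f xs = prod_encode (f xs, g xs)" for xs
    by (simp add: prod_encode_def)
qed

text \<open>Decoding by bounded search: both components are at most the code and the pairing is
  injective, so exactly one index has a partner and the sum returns it.\<close>

lemma fst_prod_decode_eq_sum:
  "fst (prod_decode c) = (\<Sum>i<Suc c. i * of_bool (\<exists>j<Suc c. prod_encode (i, j) = c))"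
proof -
  obtain x y where xy: "c = prod_encode (x, y)"
    by (metis prod_decode_inverse surj_pair)
  have "(\<Sum>i<Suc c. i * of_bool (\<exists>j<Suc c. prod_encode (i, j) = c)) = (\<Sum>i<Suc c. if i = x then x else 0)"
    by (rule sum.cong) (auto simp: xy less_Suc_eq_le le_prod_encode_2)
  then show ?thesis
    by (simp add: xy less_Suc_eq_le le_prod_encode_1 del: sum.lessThan_Suc)
qed

lemma snd_prod_decode_eq_sum:
  "snd (prod_decode c) = (\<Sum>j<Suc c. j * of_bool (\<exists>i<Suc c. prod_encode (i, j) = c))"
proof -
  obtain x y where xy: "c = prod_encode (x, y)"
    by (metis prod_decode_inverse surj_pair)
  have "(\<Sum>j<Suc c. j * of_bool (\<exists>i<Suc c. prod_encode (i, j) = c)) = (\<Sum>j<Suc c. if j = y then y else 0)"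
    by (rule sum.cong) (auto simp: xy less_Suc_eq_le le_prod_encode_1)
  then show ?thesis
    by (simp add: xy less_Suc_eq_le le_prod_encode_2 del: sum.lessThan_Suc)
qed

lemma computable_prod_decode [computable_intros]:
  assumes "computable k f"
  shows "computable k (\<lambda>xs. fst (prod_decode (f xs)))" "computable k (\<lambda>xs. snd (prod_decode (f xs)))"
  unfolding fst_prod_decode_eq_sum snd_prod_decode_eq_sum
  by (intro computable_intros assms assms[THEN computable_tl]
      assms[THEN computable_tl, THEN computable_tl]; simp)+

lemma computable_hd_code [computable_intros]:
  "computable k f \<Longrightarrow> computable k (\<lambda>xs. hd_code (f xs))"
  unfolding hd_code_def by (intro computable_intros)

lemma computable_tl_code_iter [computable_intros]:
  assumes "computable k f" "computable k e"
  shows "computable k (\<lambda>xs. (tl_code ^^ e xs) (f xs))"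
proof (rule computable_cong)
  show "computable k (\<lambda>xs. rec_nat (f xs) (\<lambda>_ y. tl_code y) (e xs))"
    unfolding tl_code_def by (intro computable_rec_nat computable_intros assms
        assms[THEN computable_tl, THEN computable_tl]) simp_all
  have "rec_nat c (\<lambda>_. tl_code) m = (tl_code ^^ m) c" for c m
    by (induction m) auto
  then show "rec_nat (f xs) (\<lambda>_. tl_code) (e xs) = (tl_code ^^ e xs) (f xs)" for xs .
qed

section \<open>Coordinates on Baumslag--Solitar groups\<close>

abbreviation "t_count w \<equiv> count_list w (gen_t, True)"
abbreviation "t_inv_count w \<equiv> count_list w (gen_t, False)"

definition texp :: "bs_gen word \<Rightarrow> int" where
  "texp w = int (t_count w) - int (t_inv_count w)"

fun numer :: "int \<Rightarrow> bs_gen word \<Rightarrow> int" where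
  "numer n [] = 0"
| "numer n ((gen_a, s) # w) = (if s then 1 else - 1) * n ^ t_inv_count w + numer n w"
| "numer n ((gen_t, s) # w) = (if s then n else 1) * numer n w"

text \<open>
  For \<open>n \<noteq> 0\<close> the word \<open>w\<close> acts on the rationals by \<open>x \<mapsto> n\<^bsup>texp w\<^esup> x + transl n w\<close>, where \<open>a\<close>
  acts by \<open>x \<mapsto> x + 1\<close> and \<open>t\<close> by \<open>x \<mapsto> n x\<close>. The integer \<open>numer n w\<close> is the numerator of the
  translation part over the denominator \<open>n\<close> to the number of letters \<open>t\<^sup>-\<^sup>1\<close>.
\<close>

definition transl :: "int \<Rightarrow> bs_gen word \<Rightarrow> rat" where
  "transl n w = of_int (numer n w) / of_int n ^ t_inv_count w"

lemma texp_simps [simp]: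
  "texp [] = 0"
  "texp ((gen_a, s) # w) = texp w"
  "texp ((gen_t, s) # w) = (if s then 1 else - 1) + texp w"
  "texp (u @ v) = texp u + texp v"
  by (auto simp: texp_def)

lemma transl_Nil [simp]: "transl n [] = 0"
  by (simp add: transl_def)

lemma transl_Cons [simp]:
  assumes "n \<noteq> 0"
  shows "transl n ((gen_a, s) # w) = (if s then 1 else - 1) + transl n w"
    "transl n ((gen_t, s) # w) = (if s then of_int n else 1 / of_int n) * transl n w"
  using assms by (auto simp: transl_def field_simps)

text \<open>The affine map of \<open>u @ v\<close> is the composite of the maps of \<open>u\<close>
  and \<open>v\<close>, with \<open>v\<close> applied first.\<close>

lemma transl_append:
  assumes "n \<noteq> 0"
  shows "transl n (u @ v) = transl n u + of_int n powi texp u * transl n v"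
proof (induction u)
  case (Cons x u)
  show ?case
  proof (cases x)
    case (Pair g s)
    then show ?thesis
      using Cons assms
      by (cases g; cases s) (auto simp: power_int_add power_int_diff field_simps)
  qed
qed simp

lemma texp_gen_pow [simp]: "texp (gen_pow gen_a k) = 0"
proof -
  have "texp (replicate m (gen_a, s)) = 0" for m s
    by (induction m) auto
  then show ?thesis by (simp add: gen_pow_def)
qed

lemma transl_gen_pow: "n \<noteq> 0 \<Longrightarrow> transl n (gen_pow gen_a k) = of_int k"
proof -
  assume "n \<noteq> 0"
  then have "transl n (replicate m (gen_a, s)) = (if s then of_nat m else - of_nat m)" for m s
    by (induction m) auto
  then show ?thesis by (auto simp: gen_pow_def)
qed

lemma texp_cong: "word_eq (BS1_rels n) u v \<Longrightarrow> texp u = texp v"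
proof (induction rule: word_eq.induct)
  case (cancel u x v)
  obtain g s where "x = (g, s)" by (cases x)
  then show ?case by (cases g) (auto simp: inv_letter_def)
qed (auto simp: BS1_rels_def)

text \<open>Both sides of the relation act as translation by 1: the leading inverse of
  \<open>t\<close> divides the translation part \<open>n\<close> by \<open>n\<close>.\<close>

lemma transl_cong:
  assumes "n \<noteq> 0"
  shows "word_eq (BS1_rels n) u v \<Longrightarrow> transl n u = transl n v"
proof (induction rule: word_eq.induct)
  case (cancel u x v)
  obtain g s where "x = (g, s)" by (cases x)
  then show ?case
    using assms by (cases g) (auto simp: inv_letter_def transl_append)
next
  case (relation l r u v)
  have "transl n (l @ v) = transl n (r @ v)" "texp l = texp r"
    using relation assms by (auto simp: BS1_rels_def transl_append transl_gen_pow field_simps)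
  then show ?case
    using assms by (simp add: transl_append[of n u])
qed auto

abbreviation inv_word :: "'g word \<Rightarrow> 'g word" where
  "inv_word w \<equiv> rev (map inv_letter w)"

text \<open>\<open>texp\<close> does not depend on \<open>n\<close>, so the relations for
  \<open>n = 0\<close> serve as well as any others.\<close>

lemma texp_inv_word [simp]: "texp (inv_word w) = - texp w"
  using texp_cong[OF word_eq_inv_left[of "BS1_rels 0" w]] by simp

lemma transl_inv_word:
  assumes "n \<noteq> 0"
  shows "transl n (inv_word w) = - (of_int n powi (- texp w)) * transl n w"
  using transl_cong[OF assms word_eq_inv_left[of "BS1_rels n" w]]
  by (simp add: transl_append[OF assms])

text \<open>The word-level form of the homomorphism sending \<open>a\<close> to \<open>p\<close> and
  \<open>t\<close> to \<open>q\<close>, defined whether or not \<open>p\<close> and \<open>q\<close>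
  satisfy the relation.\<close>

fun subst_word :: "bs_gen word \<Rightarrow> bs_gen word \<Rightarrow> bs_gen word \<Rightarrow> bs_gen word" where
  "subst_word p q [] = []"
| "subst_word p q ((g, s) # w) =
    (let r = (case g of gen_a \<Rightarrow> p | gen_t \<Rightarrow> q) in if s then r else inv_word r) @ subst_word p q w"

lemma subst_word_append: "subst_word p q (u @ v) = subst_word p q u @ subst_word p q v"
  by (induction u) auto

lemma texp_subst_word:
  assumes "texp p = 0"
  shows "texp (subst_word p q w) = texp q * texp w"
proof (induction w)
  case (Cons x w)
  obtain g s where "x = (g, s)" by (cases x)
  with Cons assms show ?case
    by (cases g) (auto simp: algebra_simps)
qed simp

lemma texp_subst_gen_pow: "texp (subst_word p q (gen_pow gen_a k)) = k * texp p"
proof -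
  have "texp (subst_word p q (replicate m (gen_a, s))) = (if s then int m else - int m) * texp p" for m s
    by (induction m) (auto simp: algebra_simps)
  then show ?thesis by (simp add: gen_pow_def)
qed

lemma texp_gen_pow_t: "texp (gen_pow gen_t k) = k"
proof -
  have "texp (replicate r (gen_t, s)) = (if s then int r else - int r)" for r s
    by (induction r) auto
  then show ?thesis
    by (auto simp: gen_pow_def)
qed

lemma elt_inv_word: "inv\<^bsub>presented_group R\<^esub> (elt R w) = elt R (inv_word w)"
proof -
  interpret group "presented_group R" by (rule group_presented_group)
  show ?thesis
    using word_eq_inv_left[of R w]
    by (intro inv_equality) (auto simp: elt_eq_iff one_presented_group)
qed

lemma elt_gen_pow: "elt R (gen_pow g k) = elt R [(g, True)] [^]\<^bsub>presented_group R\<^esub> k"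
proof -
  interpret group "presented_group R" by (rule group_presented_group)
  have pos: "elt R (replicate m x) = elt R [x] [^]\<^bsub>presented_group R\<^esub> m" for m x
  proof (induction m)
    case (Suc m)
    have "elt R (replicate (Suc m) x) = elt R (replicate m x) \<otimes>\<^bsub>presented_group R\<^esub> elt R [x]"
      by (simp add: replicate_append_same del: replicate_Suc) (simp add: replicate_append_same)
    then show ?case using Suc by simp
  qed (simp add: one_presented_group)
  have "elt R [(g, False)] = inv\<^bsub>presented_group R\<^esub> elt R [(g, True)]"
    by (simp add: elt_inv_word inv_letter_def)
  then show ?thesis
    unfolding gen_pow_def pos int_pow_def2[where z = k]
    by (cases "k < 0") (simp_all add: int_pow_inv)
qed

section \<open>Normal form and the word problem in BS(n,1)\<close>

locale baumslag_solitar =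
  fixes n :: int
begin

abbreviation "G \<equiv> BS1 n"

sublocale group G
  unfolding BS1_def by (rule group_presented_group)

definition "a = BS1_elt n [(gen_a, True)]"
definition "t = BS1_elt n [(gen_t, True)]"

lemma elt_in_carrier [simp]: "BS1_elt n w \<in> carrier G"
  by (simp add: BS1_def)

lemma gens_in_carrier [simp]: "a \<in> carrier G" "t \<in> carrier G"
  by (simp_all add: a_def t_def)

lemma elt_append: "BS1_elt n (u @ v) = BS1_elt n u \<otimes>\<^bsub>G\<^esub> BS1_elt n v"
  by (simp add: BS1_def)

lemma elt_Nil: "BS1_elt n [] = \<one>\<^bsub>G\<^esub>"
  by (simp add: BS1_def one_presented_group)

lemma elt_Cons:
  "BS1_elt n ((gen_a, s) # w) = (if s then a else inv\<^bsub>G\<^esub> a) \<otimes>\<^bsub>G\<^esub> BS1_elt n w"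
  "BS1_elt n ((gen_t, s) # w) = (if s then t else inv\<^bsub>G\<^esub> t) \<otimes>\<^bsub>G\<^esub> BS1_elt n w"
proof -
  have "BS1_elt n [(g, False)] = inv\<^bsub>G\<^esub> BS1_elt n [(g, True)]" for g
    by (simp add: BS1_def elt_inv_word inv_letter_def)
  then show "BS1_elt n ((gen_a, s) # w) = (if s then a else inv\<^bsub>G\<^esub> a) \<otimes>\<^bsub>G\<^esub> BS1_elt n w"
    "BS1_elt n ((gen_t, s) # w) = (if s then t else inv\<^bsub>G\<^esub> t) \<otimes>\<^bsub>G\<^esub> BS1_elt n w"
    using elt_append[of "[(gen_a, s)]" w] elt_append[of "[(gen_t, s)]" w]
    by (cases s; simp add: a_def t_def)+
qed

lemma inv_cancel:
  "x \<in> carrier G \<Longrightarrow> y \<in> carrier G \<Longrightarrow> inv\<^bsub>G\<^esub> x \<otimes>\<^bsub>G\<^esub> (x \<otimes>\<^bsub>G\<^esub> y) = y"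
  "x \<in> carrier G \<Longrightarrow> y \<in> carrier G \<Longrightarrow> x \<otimes>\<^bsub>G\<^esub> (inv\<^bsub>G\<^esub> x \<otimes>\<^bsub>G\<^esub> y) = y"
  by (simp_all flip: m_assoc)

lemma elt_relation: "BS1_elt n ((gen_t, False) # gen_pow gen_a n @ [(gen_t, True)]) =
    BS1_elt n [(gen_a, True)]"
proof -
  have "word_eq (BS1_rels n) ([] @ ([(gen_t, False)] @ gen_pow gen_a n @ [(gen_t, True)]) @ [])
      ([] @ [(gen_a, True)] @ [])"
    by (rule word_eq.relation) (simp add: BS1_rels_def)
  then show ?thesis
    by (simp add: elt_eq_iff)
qed

lemma t_conj: "t \<otimes>\<^bsub>G\<^esub> a = a [^]\<^bsub>G\<^esub> n \<otimes>\<^bsub>G\<^esub> t"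
proof -
  have "BS1_elt n ((gen_t, False) # gen_pow gen_a n @ [(gen_t, True)]) = a"
    unfolding elt_relation a_def ..
  moreover have "BS1_elt n (gen_pow gen_a n) = a [^]\<^bsub>G\<^esub> n"
    by (simp add: BS1_def a_def elt_gen_pow)
  ultimately have "a = inv\<^bsub>G\<^esub> t \<otimes>\<^bsub>G\<^esub> (a [^]\<^bsub>G\<^esub> n \<otimes>\<^bsub>G\<^esub> t)"
    by (simp add: elt_Cons elt_append elt_Nil)
  then show ?thesis
    by (simp add: inv_solve_left)
qed

lemma t_conj_int_pow: "t \<otimes>\<^bsub>G\<^esub> a [^]\<^bsub>G\<^esub> k = a [^]\<^bsub>G\<^esub> (n * k) \<otimes>\<^bsub>G\<^esub> t" for k :: int
proof -
  \<comment> \<open>Conjugation by \<open>t\<close> is an endomorphism sending \<open>a\<close> to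
    its \<open>n\<close>-th power, which determines it on all powers of \<open>a\<close>.\<close>
  define c where "c x = t \<otimes>\<^bsub>G\<^esub> x \<otimes>\<^bsub>G\<^esub> inv\<^bsub>G\<^esub> t" for x
  have "c \<in> hom G G"
    by (rule homI) (simp_all add: c_def m_assoc inv_cancel)
  then interpret c: group_hom G G c
    by unfold_locales
  have "c a = a [^]\<^bsub>G\<^esub> n"
    by (simp add: c_def t_conj m_assoc)
  then have "c (a [^]\<^bsub>G\<^esub> k) = a [^]\<^bsub>G\<^esub> (n * k)"
    by (simp add: c.hom_int_pow int_pow_pow)
  moreover have "c (a [^]\<^bsub>G\<^esub> k) \<otimes>\<^bsub>G\<^esub> t = t \<otimes>\<^bsub>G\<^esub> a [^]\<^bsub>G\<^esub> k"
    by (simp add: c_def m_assoc)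
  ultimately show ?thesis
    by simp
qed

lemma t_pow_conj: "t [^]\<^bsub>G\<^esub> m \<otimes>\<^bsub>G\<^esub> a [^]\<^bsub>G\<^esub> k = a [^]\<^bsub>G\<^esub> (n ^ m * k) \<otimes>\<^bsub>G\<^esub> t [^]\<^bsub>G\<^esub> m"
  for m :: nat and k :: int
proof (induction m arbitrary: k)
  case (Suc m)
  have "t [^]\<^bsub>G\<^esub> Suc m \<otimes>\<^bsub>G\<^esub> a [^]\<^bsub>G\<^esub> k = t [^]\<^bsub>G\<^esub> m \<otimes>\<^bsub>G\<^esub> a [^]\<^bsub>G\<^esub> (n * k) \<otimes>\<^bsub>G\<^esub> t"
    by (simp add: m_assoc t_conj_int_pow)
  also have "\<dots> = a [^]\<^bsub>G\<^esub> (n ^ Suc m * k) \<otimes>\<^bsub>G\<^esub> t [^]\<^bsub>G\<^esub> Suc m"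
    by (simp add: Suc m_assoc mult_ac)
  finally show ?case .
qed simp

text \<open>The exponents \<open>q\<close> and \<open>p\<close> are not reduced, so the form is not
  unique; in exchange, multiplication by a letter on the left never needs a cancellation.\<close>

definition nform :: "nat \<Rightarrow> int \<Rightarrow> nat \<Rightarrow> bs_gen word set" where
  "nform q k p = inv\<^bsub>G\<^esub> (t [^]\<^bsub>G\<^esub> q) \<otimes>\<^bsub>G\<^esub> (a [^]\<^bsub>G\<^esub> k \<otimes>\<^bsub>G\<^esub> t [^]\<^bsub>G\<^esub> p)"

lemma a_pow_nform: "a [^]\<^bsub>G\<^esub> j \<otimes>\<^bsub>G\<^esub> nform q k p = nform q (j * n ^ q + k) p" for j :: int
proof -
  have "a [^]\<^bsub>G\<^esub> j \<otimes>\<^bsub>G\<^esub> inv\<^bsub>G\<^esub> (t [^]\<^bsub>G\<^esub> q) = inv\<^bsub>G\<^esub> (t [^]\<^bsub>G\<^esub> q) \<otimes>\<^bsub>G\<^esub> a [^]\<^bsub>G\<^esub> (j * n ^ q)"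
  proof -
    have "t [^]\<^bsub>G\<^esub> q \<otimes>\<^bsub>G\<^esub> (a [^]\<^bsub>G\<^esub> j \<otimes>\<^bsub>G\<^esub> inv\<^bsub>G\<^esub> (t [^]\<^bsub>G\<^esub> q)) = a [^]\<^bsub>G\<^esub> (j * n ^ q)"
      using t_pow_conj[of q j] by (simp add: m_assoc[symmetric] mult.commute) (simp add: m_assoc)
    then show ?thesis
      using inv_cancel(1)[of "t [^]\<^bsub>G\<^esub> q" "a [^]\<^bsub>G\<^esub> j \<otimes>\<^bsub>G\<^esub> inv\<^bsub>G\<^esub> (t [^]\<^bsub>G\<^esub> q)"] by simp
  qed
  then show ?thesis
    by (simp add: nform_def m_assoc[symmetric] int_pow_mult)
qed

lemma t_nform: "t \<otimes>\<^bsub>G\<^esub> nform q k p = nform q (n * k) (Suc p)"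
proof -
  have "t \<otimes>\<^bsub>G\<^esub> inv\<^bsub>G\<^esub> (t [^]\<^bsub>G\<^esub> q) = inv\<^bsub>G\<^esub> (t [^]\<^bsub>G\<^esub> q) \<otimes>\<^bsub>G\<^esub> t"
  proof -
    have "t [^]\<^bsub>G\<^esub> q \<otimes>\<^bsub>G\<^esub> t = t \<otimes>\<^bsub>G\<^esub> t [^]\<^bsub>G\<^esub> q"
      using nat_pow_Suc2[of t q] by simp
    then have "t [^]\<^bsub>G\<^esub> q \<otimes>\<^bsub>G\<^esub> (t \<otimes>\<^bsub>G\<^esub> inv\<^bsub>G\<^esub> (t [^]\<^bsub>G\<^esub> q)) = t"
      by (simp add: m_assoc[symmetric]) (simp add: m_assoc)
    then show ?thesis
      using inv_cancel(1)[of "t [^]\<^bsub>G\<^esub> q" "t \<otimes>\<^bsub>G\<^esub> inv\<^bsub>G\<^esub> (t [^]\<^bsub>G\<^esub> q)"] by simp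
  qed
  then have "t \<otimes>\<^bsub>G\<^esub> nform q k p =
      inv\<^bsub>G\<^esub> (t [^]\<^bsub>G\<^esub> q) \<otimes>\<^bsub>G\<^esub> (t \<otimes>\<^bsub>G\<^esub> a [^]\<^bsub>G\<^esub> k \<otimes>\<^bsub>G\<^esub> t [^]\<^bsub>G\<^esub> p)"
    by (simp add: nform_def m_assoc[symmetric])
  then show ?thesis
    using nat_pow_Suc2[of t p] by (simp add: t_conj_int_pow nform_def m_assoc)
qed

lemma inv_t_nform: "inv\<^bsub>G\<^esub> t \<otimes>\<^bsub>G\<^esub> nform q k p = nform (Suc q) k p"
  by (simp add: nform_def m_assoc[symmetric] inv_mult_group)

text \<open>Insert \<open>t^-1 t\<close> in front \<open>i\<close> times and absorb the letters.
  This brings forms with different \<open>q\<close> to a common one.\<close>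

lemma nform_shift: "nform q k p = nform (i + q) (n ^ i * k) (i + p)"
proof (induction i)
  case (Suc i)
  have "nform q k p = inv\<^bsub>G\<^esub> t \<otimes>\<^bsub>G\<^esub> (t \<otimes>\<^bsub>G\<^esub> nform q k p)"
    by (simp add: nform_def inv_cancel)
  with Suc show ?case
    by (simp add: t_nform inv_t_nform mult_ac)
qed simp

text \<open>Left multiplication by a letter changes the three parameters exactly as the recursions
  for the letter counts and \<open>numer\<close> do.\<close>

lemma elt_eq_nform: "BS1_elt n w = nform (t_inv_count w) (numer n w) (t_count w)"
proof (induction w)
  case Nil
  then show ?case by (simp add: nform_def elt_Nil)
next
  case (Cons x w)
  obtain g s where "x = (g, s)" by (cases x)
  then show ?case
    using a_pow_nform[of 1] a_pow_nform[of "-1"]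
    by (cases g; cases s)
      (auto simp: elt_Cons Cons t_nform inv_t_nform int_pow_neg)
qed

text \<open>The affine action is faithful: if the coordinates agree, the forms of \<open>u\<close>
  and \<open>v\<close> coincide once both are shifted to the first exponent
  \<open>t_inv_count u + t_inv_count v\<close>.\<close>

lemma BS1_elt_eq_iff:
  assumes "n \<noteq> 0"
  shows "BS1_elt n u = BS1_elt n v \<longleftrightarrow> texp u = texp v \<and> transl n u = transl n v"
proof
  assume "BS1_elt n u = BS1_elt n v"
  then show "texp u = texp v \<and> transl n u = transl n v"
    unfolding elt_eq_iff using texp_cong transl_cong[OF assms] by blast
next
  assume eq: "texp u = texp v \<and> transl n u = transl n v"
  then have "n ^ t_inv_count v * numer n u = n ^ t_inv_count u * numer n v"
    using assms by (simp add: transl_def field_simps flip: of_int_power of_int_mult)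
  moreover have "t_inv_count v + t_count u = t_inv_count u + t_count v"
    using eq by (simp add: texp_def)
  ultimately show "BS1_elt n u = BS1_elt n v"
    unfolding elt_eq_nform
    using nform_shift[of "t_inv_count u" "numer n u" "t_count u" "t_inv_count v"]
      nform_shift[of "t_inv_count v" "numer n v" "t_count v" "t_inv_count u"]
    by (simp add: add.commute)
qed

lemma BS1_0_elt_eq_iff:
  assumes "n = 0"
  shows "BS1_elt n u = BS1_elt n v \<longleftrightarrow> texp u = texp v"
proof
  assume "BS1_elt n u = BS1_elt n v"
  then show "texp u = texp v"
    unfolding elt_eq_iff by (rule texp_cong)
next
  assume eq: "texp u = texp v"
  have "a [^]\<^bsub>G\<^esub> n = \<one>\<^bsub>G\<^esub>"
    unfolding assms by (rule int_pow_0)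
  \<comment> \<open>For \<open>n = 0\<close> the relation reads \<open>t a = t\<close>.\<close>
  then have "a = \<one>\<^bsub>G\<^esub>"
    using t_conj by (simp add: l_cancel_one)
  then have "nform q k p = nform q 0 p" for q k p
    by (simp add: nform_def)
  moreover have "t_inv_count v + t_count u = t_inv_count u + t_count v"
    using eq by (simp add: texp_def)
  ultimately show "BS1_elt n u = BS1_elt n v"
    unfolding elt_eq_nform
    using nform_shift[of "t_inv_count u" "numer n u" "t_count u" "t_inv_count v"]
      nform_shift[of "t_inv_count v" "numer n v" "t_count v" "t_inv_count u"]
    by (metis add.commute)
qed

lemma hom_elt:
  assumes "\<phi> \<in> hom G G" "\<phi> a = BS1_elt n p" "\<phi> t = BS1_elt n q"
  shows "\<phi> (BS1_elt n w) = BS1_elt n (subst_word p q w)"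
proof -
  interpret \<phi>: group_hom G G \<phi>
    using assms(1) by unfold_locales
  have inv: "BS1_elt n (inv_word w) = inv\<^bsub>G\<^esub> BS1_elt n w" for w
    by (simp add: BS1_def elt_inv_word)
  show ?thesis
  proof (induction w)
    case Nil
    then show ?case by (simp add: elt_Nil)
  next
    case (Cons x w)
    obtain g s where "x = (g, s)" by (cases x)
    then show ?case
      using assms(2,3)
      by (cases g; cases s) (auto simp: elt_Cons elt_append inv Cons)
  qed
qed

text \<open>Moving the inverse to the other side gives phi(x) v = u x, which involves only words
  without inversion.\<close>

lemma twisted_conjugate_iff:
  assumes "\<phi> \<in> hom G G" "\<phi> a = BS1_elt n p" "\<phi> t = BS1_elt n q"
  shows "twisted_conjugate G \<phi> (BS1_elt n u) (BS1_elt n v) \<longleftrightarrow>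
    (\<exists>w. BS1_elt n (subst_word p q w @ v) = BS1_elt n (u @ w))"
proof -
  have ex: "(\<exists>x\<in>carrier G. P x) \<longleftrightarrow> (\<exists>w. P (BS1_elt n w))" for P
    by (simp add: BS1_def)
  have "twisted_conjugate G \<phi> (BS1_elt n u) (BS1_elt n v) \<longleftrightarrow>
    (\<exists>w. BS1_elt n v = inv\<^bsub>G\<^esub> BS1_elt n (subst_word p q w) \<otimes>\<^bsub>G\<^esub> (BS1_elt n u \<otimes>\<^bsub>G\<^esub> BS1_elt n w))"
    by (simp add: twisted_conjugate_def ex hom_elt[OF assms] m_assoc)
  also have "\<dots> \<longleftrightarrow> (\<exists>w. BS1_elt n (subst_word p q w @ v) = BS1_elt n (u @ w))"
    by (simp add: inv_solve_left elt_append eq_commute)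
  finally show ?thesis .
qed

end

section \<open>Exponential and linear Diophantine conditions\<close>

text \<open>Among the exponents 0, ..., |A| two, r < s, give the same residue by the pigeonhole
  principle. Any exponent that is at least |A| can then be lowered by s - r.\<close>

lemma power_cong_small_exponent:
  fixes n A :: int
  assumes "A \<noteq> 0"
  shows "\<exists>i'<nat \<bar>A\<bar>. A dvd n ^ i - n ^ i'"
proof (induction i rule: less_induct)
  case (less i)
  show ?case
  proof (cases "i < nat \<bar>A\<bar>")
    case False
    have "\<not> inj_on (\<lambda>r. n ^ r mod \<bar>A\<bar>) {..nat \<bar>A\<bar>}"
    proof
      assume "inj_on (\<lambda>r. n ^ r mod \<bar>A\<bar>) {..nat \<bar>A\<bar>}"
      moreover have "(\<lambda>r. n ^ r mod \<bar>A\<bar>) ` {..nat \<bar>A\<bar>} \<subseteq> {0..<\<bar>A\<bar>}"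
        using assms by auto
      ultimately have "card {..nat \<bar>A\<bar>} \<le> card {0..<\<bar>A\<bar>}"
        by (intro card_inj_on_le) auto
      then show False by simp
    qed
    then obtain r s where rs: "r < s" "s \<le> nat \<bar>A\<bar>" "n ^ r mod \<bar>A\<bar> = n ^ s mod \<bar>A\<bar>"
      unfolding inj_on_def by (metis atMost_iff linorder_neqE_nat)
    then have "A dvd n ^ s - n ^ r"
      by (simp add: mod_eq_dvd_iff dvd_diff_commute)
    then have "A dvd n ^ (i - s) * (n ^ s - n ^ r)"
      by simp
    moreover have "n ^ (i - s) * (n ^ s - n ^ r) = n ^ i - n ^ (i - s + r)"
      using rs False by (simp add: algebra_simps flip: power_add)
    ultimately have *: "A dvd n ^ i - n ^ (i - s + r)"
      by simp
    have "i - s + r < i"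
      using rs False by simp
    from less[OF this] obtain i' where "i' < nat \<bar>A\<bar>" "A dvd n ^ (i - s + r) - n ^ i'"
      by blast
    with * show ?thesis
      using dvd_add[of A "n ^ i - n ^ (i - s + r)" "n ^ (i - s + r) - n ^ i'"] by auto
  qed (intro exI[of _ i], simp)
qed

text \<open>Cancel the common power of \<open>n\<close>, so that one exponent becomes 0. The other,
  m, satisfies m < 2^m <= |n|^m, and |n|^m is at most the absolute value of the nonzero
  product.\<close>

lemma power_mult_eq_small_exponents:
  fixes n X Y :: int
  assumes n: "\<bar>n\<bar> \<ge> 2" and eq: "n ^ i * X = n ^ j * Y"
  shows "\<exists>i' j'. i' \<le> nat \<bar>Y\<bar> \<and> j' \<le> nat \<bar>X\<bar> \<and> n ^ i' * X = n ^ j' * Y"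
proof -
  have bound: "m \<le> nat \<bar>Z\<bar>" if "n ^ m * Z' = Z" "Z \<noteq> 0" for m Z Z'
  proof -
    have "int m < 2 ^ m"
      by (metis of_nat_less_two_power)
    also have "\<dots> \<le> \<bar>n\<bar> ^ m"
      using n by (intro power_mono) auto
    also have "\<dots> \<le> \<bar>n ^ m * Z'\<bar>"
      using that by (auto simp: abs_mult power_abs mult_le_cancel_left1)
    finally show ?thesis
      using that by simp
  qed
  have n0: "n \<noteq> 0" using n by auto
  show ?thesis
  proof (cases "X = 0 \<or> Y = 0")
    case True
    then have "X = 0" "Y = 0"
      using eq n0 by auto
    then show ?thesis by simp
  next
    case False
    consider "i \<le> j" | "j \<le> i" by linarith
    then show ?thesis
    proof cases
      case 1
      then have "n ^ i * X = n ^ i * (n ^ (j - i) * Y)"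
        using eq by (simp flip: mult.assoc power_add)
      then have "n ^ (j - i) * Y = X"
        using n0 by simp
      then show ?thesis
        using bound[of "j - i" Y X] False by (intro exI[of _ 0] exI[of _ "j - i"]) auto
    next
      case 2
      then have "n ^ j * (n ^ (i - j) * X) = n ^ j * Y"
        using eq by (simp flip: mult.assoc power_add)
      then have "n ^ (i - j) * X = Y"
        using n0 by simp
      then show ?thesis
        using bound[of "i - j" X Y] False by (intro exI[of _ "i - j"] exI[of _ 0]) auto
    qed
  qed
qed

lemma ex_exponents_bounded:
  fixes n A X Y \<delta> d :: int
  assumes n: "n \<noteq> 0" "n \<noteq> 1" and \<delta>: "\<delta> = 0 \<or> n = - 1"
    and B: "B = nat \<bar>A\<bar> + nat \<bar>X\<bar> + nat \<bar>Y\<bar> + nat \<bar>d\<bar> + 2"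
  shows "(\<exists>i j. \<delta> * (int j - int i) = d \<and> A dvd n ^ i * X - n ^ j * Y) \<longleftrightarrow>
    (\<exists>i<B. \<exists>j<B. \<delta> * (int j - int i) = d \<and> A dvd n ^ i * X - n ^ j * Y)"
proof
  assume "\<exists>i j. \<delta> * (int j - int i) = d \<and> A dvd n ^ i * X - n ^ j * Y"
  then obtain i j where ij: "\<delta> * (int j - int i) = d" "A dvd n ^ i * X - n ^ j * Y"
    by blast
  consider "\<delta> \<noteq> 0" "n = - 1" | "\<delta> = 0" "n = - 1" | "\<delta> = 0" "n \<noteq> - 1" "A = 0" | "\<delta> = 0" "n \<noteq> - 1" "A \<noteq> 0"
    using \<delta> by blast
  then show "\<exists>i<B. \<exists>j<B. \<delta> * (int j - int i) = d \<and> A dvd n ^ i * X - n ^ j * Y"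
  proof cases
    case 1
    \<comment> \<open>Only j - i is prescribed, and |j - i| <= |d|. Removing the factor n^m makes
      the smaller exponent 0; since n^m is its own inverse, divisibility by \<open>A\<close>
      survives.\<close>
    define m where "m = min i j"
    have "n ^ i * X - n ^ j * Y = n ^ m * (n ^ (i - m) * X - n ^ (j - m) * Y)"
      by (simp add: m_def right_diff_distrib flip: mult.assoc power_add)
    moreover have "n ^ m * n ^ m = 1"
      using 1 by (simp flip: power_mult_distrib)
    ultimately have "n ^ (i - m) * X - n ^ (j - m) * Y = n ^ m * (n ^ i * X - n ^ j * Y)"
      by (simp flip: mult.assoc)
    then have "A dvd n ^ (i - m) * X - n ^ (j - m) * Y"
      using ij(2) by simp
    moreover have "int (j - m) - int (i - m) = int j - int i"
      by (simp add: m_def)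
    moreover have "\<bar>int j - int i\<bar> \<le> \<bar>d\<bar>"
      using ij(1) 1 by (auto simp: abs_mult mult_le_cancel_right1)
    then have "i - m \<le> nat \<bar>d\<bar> \<and> j - m \<le> nat \<bar>d\<bar>"
      by (cases "i \<le> j") (simp_all add: m_def le_nat_iff of_nat_diff)
    then have "i - m < B" "j - m < B"
      unfolding B by simp_all
    ultimately show ?thesis
      using ij(1) by metis
  next
    case 2
    \<comment> \<open>From here on the first equation constrains neither exponent, so both may be
      changed independently. Powers of -1 depend on parity only; the \<open>+ 2\<close> in
      \<open>B\<close> makes room for exponents 0 and 1.\<close>
    have parity: "n ^ (r mod 2) = n ^ r" for r
      using 2 by (cases "even r") (auto simp: odd_iff_mod_2_eq_one even_iff_mod_2_eq_zero)
    have "\<delta> * (int (j mod 2) - int (i mod 2)) = d \<and> A dvd n ^ (i mod 2) * X - n ^ (j mod 2) * Y"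
      using ij 2(1) unfolding parity by simp
    moreover have "i mod 2 < B" "j mod 2 < B"
      by (simp_all add: B less_le_trans[of _ 2])
    ultimately show ?thesis
      by blast
  next
    case 3
    then have "\<bar>n\<bar> \<ge> 2" "n ^ i * X = n ^ j * Y"
      using n ij(2) by auto
    then obtain i' j' where "i' \<le> nat \<bar>Y\<bar>" "j' \<le> nat \<bar>X\<bar>" "n ^ i' * X = n ^ j' * Y"
      using power_mult_eq_small_exponents by blast
    moreover from this have "i' < B" "j' < B"
      unfolding B by linarith+
    ultimately show ?thesis
      using ij(1) 3 by (intro exI[of _ i'] exI[of _ j'] conjI) auto
  next
    case 4
    obtain i' where i': "i' < nat \<bar>A\<bar>" "A dvd n ^ i - n ^ i'"
      using power_cong_small_exponent[OF 4(3)] by blast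
    obtain j' where j': "j' < nat \<bar>A\<bar>" "A dvd n ^ j - n ^ j'"
      using power_cong_small_exponent[OF 4(3)] by blast
    have "A dvd (n ^ i * X - n ^ j * Y) - (n ^ i - n ^ i') * X + (n ^ j - n ^ j') * Y"
      by (rule dvd_add[OF dvd_diff[OF ij(2) dvd_mult2[OF i'(2)]] dvd_mult2[OF j'(2)]])
    then have "A dvd n ^ i' * X - n ^ j' * Y"
      by (simp add: algebra_simps)
    moreover have "i' < B" "j' < B"
      using i' j' unfolding B by linarith+
    ultimately show ?thesis
      using ij(1) 4 by (intro exI[of _ i'] exI[of _ j'] conjI) auto
  qed
qed blast

lemma ex_rational_solution_iff:
  fixes n A X Y \<delta> d :: int
  assumes n: "n \<noteq> 0"
  shows "(\<exists>c e m. \<delta> * m = d \<and>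
      of_int A / of_int n ^ r * (of_int c / of_int n ^ e) =
      (of_int X / of_int n ^ s - of_int n powi m * (of_int Y / of_int n ^ s) :: rat)) \<longleftrightarrow>
    (\<exists>i j. \<delta> * (int j - int i) = d \<and> A dvd n ^ i * X - n ^ j * Y)"
    (is "(\<exists>c e m. ?L c e m) \<longleftrightarrow> (\<exists>i j. ?R i j)")
proof
  assume "\<exists>c e m. ?L c e m"
  then obtain c e m where L: "?L c e m" by blast
  \<comment> \<open>The summand \<open>nat (- m)\<close> makes i + m a natural number; with e + r,
    multiplication by n^(i + s) clears every denominator.\<close>
  define i where "i = e + r + nat (- m)"
  define j where "j = nat (int i + m)"
  have m: "m = int j - int i"
    by (auto simp: i_def j_def)
  have "of_int (n ^ i * X - n ^ j * Y) =
      (of_int n ^ (i + s) * (of_int X / of_int n ^ s - of_int n powi m * (of_int Y / of_int n ^ s)) :: rat)"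
    using n by (simp add: m power_int_diff field_simps power_add)
  also have "\<dots> = of_int n ^ (i + s) * (of_int A / of_int n ^ r * (of_int c / of_int n ^ e))"
    using L by simp
  also have "\<dots> = of_int (A * (c * n ^ (s + nat (- m))))"
    using n by (simp add: i_def power_add field_simps)
  finally have "n ^ i * X - n ^ j * Y = A * (c * n ^ (s + nat (- m)))"
    unfolding of_int_eq_iff .
  then have "?R i j"
    using L m by simp
  then show "\<exists>i j. ?R i j" by blast
next
  assume "\<exists>i j. ?R i j"
  then obtain i j c where ij: "\<delta> * (int j - int i) = d" "n ^ i * X - n ^ j * Y = A * c"
    by (auto simp: dvd_def)
  \<comment> \<open>The factor n^r in the numerator of z cancels the denominator of the
    coefficient.\<close>
  have "of_int A / of_int n ^ r * (of_int (c * n ^ r) / of_int n ^ (i + s)) =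
      (of_int (A * c) / of_int n ^ (i + s) :: rat)"
    using n by simp
  also have "\<dots> = of_int X / of_int n ^ s - of_int n powi (int j - int i) * (of_int Y / of_int n ^ s)"
    using n by (simp add: power_int_diff field_simps power_add flip: ij(2))
  finally have "?L (c * n ^ r) (i + s) (int j - int i)"
    using ij(1) by blast
  then show "\<exists>c e m. ?L c e m" by blast
qed

text \<open>Cramer's rule for nonzero determinant. Otherwise the rows are proportional: if (a, b) is
  nonzero, compatible right-hand sides make every Bezout solution of the first equation solve the
  second; if a = b = 0, only the second equation remains.\<close>

lemma ex_linear_system_solution_iff:
  fixes a b c d e f :: int
  shows "(\<exists>z m. a * z + b * m = e \<and> c * z + d * m = f) \<longleftrightarrow>
    (if a * d - b * c = 0 then a * f = c * e \<and> b * f = d * e \<and> gcd a b dvd e \<and> gcd c d dvd f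
     else (a * d - b * c) dvd (d * e - b * f) \<and> (a * d - b * c) dvd (a * f - c * e))"
    (is "?L \<longleftrightarrow> ?R")
proof
  assume ?L
  then obtain z m where zm: "a * z + b * m = e" "c * z + d * m = f" by blast
  have "d * e - b * f = (a * d - b * c) * z" "a * f - c * e = (a * d - b * c) * m"
    unfolding zm[symmetric] by (simp_all add: algebra_simps)
  moreover have "gcd a b dvd e" "gcd c d dvd f"
    unfolding zm[symmetric] by simp_all
  ultimately show ?R
    by (cases "a * d - b * c = 0") simp_all
next
  assume R: ?R
  show ?L
  proof (cases "a * d - b * c = 0")
    case False
    then obtain z m where "d * e - b * f = (a * d - b * c) * z" "a * f - c * e = (a * d - b * c) * m"
      using R by (auto simp: dvd_def)
    then have "(a * d - b * c) * (a * z + b * m) = (a * d - b * c) * e"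
      "(a * d - b * c) * (c * z + d * m) = (a * d - b * c) * f"
      by algebra+
    then show ?thesis
      using False by auto
  next
    case True
    with R have R: "a * f = c * e" "b * f = d * e" "gcd a b dvd e" "gcd c d dvd f"
      by auto
    have bezout: "\<exists>z m. x * z + y * m = k" if k: "gcd x y dvd k" for x y k :: int
    proof -
      obtain r s where "r * x + s * y = gcd x y"
        using bezout_int by blast
      moreover obtain q where "k = gcd x y * q"
        using k by blast
      moreover have "x * (r * q) + y * (s * q) = (r * x + s * y) * q"
        by (simp add: algebra_simps)
      ultimately have "x * (r * q) + y * (s * q) = k"
        by simp
      then show ?thesis by blast
    qed
    show ?thesis
    proof (cases "a = 0 \<and> b = 0")
      case True
      then have "e = 0"
        using R(3) by simp
      with True show ?thesis
        using bezout[OF R(4)] by simp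
    next
      case False
      obtain z m where zm: "a * z + b * m = e"
        using bezout[OF R(3)] by blast
      have "a * (c * z + d * m) = a * f" "b * (c * z + d * m) = b * f"
        using True R(1,2) zm by algebra+
      with False zm show ?thesis
        by auto
    qed
  qed
qed

text \<open>The gcd is itself one of the common divisors tested, unless a = b = 0; then |e| + 1 is
  tested and forces e = 0. This avoids computing a gcd.\<close>

lemma gcd_dvd_iff_bounded:
  fixes a b e :: int
  shows "gcd a b dvd e \<longleftrightarrow>
    (\<forall>g<nat \<bar>a\<bar> + nat \<bar>b\<bar> + nat \<bar>e\<bar> + 2. int g dvd a \<and> int g dvd b \<longrightarrow> int g dvd e)" (is "_ \<longleftrightarrow> ?R")
proof
  assume R: ?R
  show "gcd a b dvd e"
  proof (cases "a = 0 \<and> b = 0")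
    case True
    then have "int (nat \<bar>e\<bar> + 1) dvd e"
      using R by (auto dest!: spec[of _ "nat \<bar>e\<bar> + 1"])
    then have "e = 0"
      using zdvd_imp_le[of "int (nat \<bar>e\<bar> + 1)" "\<bar>e\<bar>"] by (cases "e = 0") auto
    then show ?thesis by simp
  next
    case False
    have "gcd a b \<le> \<bar>a\<bar> + \<bar>b\<bar>"
      using False gcd_le1_int[of "\<bar>a\<bar>" "\<bar>b\<bar>"] gcd_le2_int[of "\<bar>b\<bar>" "\<bar>a\<bar>"] by (cases "a = 0") auto
    then have "nat (gcd a b) < nat \<bar>a\<bar> + nat \<bar>b\<bar> + nat \<bar>e\<bar> + 2"
      by linarith
    then show ?thesis
      using R by (auto dest!: spec[of _ "nat (gcd a b)"])
  qed
qed (meson dvd_trans gcd_greatest)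

section \<open>Twisted conjugacy in coordinates\<close>

context baumslag_solitar
begin

lemma transl_subst_gen_pow:
  assumes "n \<noteq> 0" "texp p = 0"
  shows "transl n (subst_word p q (gen_pow gen_a k)) = of_int k * transl n p"
proof -
  have "transl n (subst_word p q (replicate m (gen_a, s))) =
      (if s then of_nat m else - of_nat m) * transl n p" for m s
    by (induction m) (auto simp: algebra_simps transl_append transl_inv_word assms)
  then show ?thesis by (auto simp: gen_pow_def)
qed

text \<open>The image of \<open>a\<close> is a translation, and that of \<open>t\<close> has the
  same linear factor \<open>n\<close> as \<open>t\<close>. The last term is
  \<open>transl n q\<close> times the geometric sum 1 + n + ... + n^(m-1) in closed form, with m =
  \<open>texp w\<close>, which also covers negative m.\<close>

lemma transl_subst_word:
  assumes n: "n \<noteq> 0" "n \<noteq> 1" and p: "texp p = 0" and q: "(of_int n :: rat) powi texp q = of_int n"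
  shows "transl n (subst_word p q w) =
    transl n p * transl n w + transl n q * ((of_int n powi texp w - 1) / of_int (n - 1))"
proof (induction w)
  case (Cons x w)
  obtain g s where x: "x = (g, s)" by (cases x)
  have n': "(of_int n :: rat) - 1 \<noteq> 0"
    using n by simp
  have q': "(of_int n :: rat) powi (- texp q) = 1 / of_int n"
    using q by (simp add: power_int_minus divide_inverse)
  show ?case
    using n n' p q q' unfolding x
    by (cases g; cases s)
      (auto simp: transl_append transl_inv_word Cons power_int_add power_int_diff field_simps)
qed simp

text \<open>The word t^-e a^c t^(m+e) does it. Quantifying over words thus becomes quantifying over
  coordinates.\<close>

lemma surj_texp_transl:
  assumes "n \<noteq> 0"
  shows "\<exists>w. texp w = m \<and> transl n w = of_int c / of_int n ^ e"
proof -
  have T: "texp (replicate e (gen_t, False)) = - int e" "transl n (replicate e (gen_t, False)) = 0"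
    using assms by (induction e) auto
  have t: "transl n (gen_pow gen_t k) = 0" for k
  proof -
    have "transl n (replicate r (gen_t, s)) = 0" for r s
      using assms by (induction r) auto
    then show ?thesis
      by (simp add: gen_pow_def)
  qed
  show ?thesis
    using assms
    by (intro exI[of _ "replicate e (gen_t, False) @ gen_pow gen_a c @ gen_pow gen_t (m + int e)"])
      (auto simp: T t texp_gen_pow_t transl_append transl_gen_pow power_int_minus field_simps)
qed

text \<open>\<open>numer\<close> and \<open>texp\<close> are additive here and identify the group
  with Z^2. The endomorphism becomes the matrix whose columns are the coordinates of
  \<open>p\<close> and \<open>q\<close>; the system is this matrix minus the identity applied to (z,
  m).\<close>

lemma twisted_conjugate_iff_1:
  assumes \<phi>: "\<phi> \<in> hom G G" "\<phi> a = BS1_elt n p" "\<phi> t = BS1_elt n q" and n: "n = 1"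
  shows "twisted_conjugate G \<phi> (BS1_elt n u) (BS1_elt n v) \<longleftrightarrow>
    (\<exists>z m. (numer n p - 1) * z + numer n q * m = numer n u - numer n v \<and>
           texp p * z + (texp q - 1) * m = texp u - texp v)"
proof -
  have numer: "transl n w = of_int (numer n w)" for w
    by (simp add: transl_def n)
  have append: "numer n (w @ w') = numer n w + numer n w'" for w w'
    using transl_append[of n w w'] n unfolding numer by (simp flip: of_int_add)
  have inv: "numer n (inv_word w) = - numer n w" for w
    using transl_inv_word[of n w] n unfolding numer by (simp flip: of_int_minus)
  have surj: "\<exists>w. texp w = m \<and> numer n w = z" for z m
    using surj_texp_transl[of m z 0] n unfolding numer by simp
  have eq_iff: "BS1_elt n w = BS1_elt n w' \<longleftrightarrow> texp w = texp w' \<and> numer n w = numer n w'" for w w'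
    using n BS1_elt_eq_iff[of w w'] unfolding numer by simp
  have subst: "numer n (subst_word p q w) = numer n p * numer n w + numer n q * texp w"
    "texp (subst_word p q w) = texp p * numer n w + texp q * texp w" for w
  proof (induction w)
    case (Cons x w)
    obtain g s where x: "x = (g, s)" by (cases x)
    {
      case 1
      then show ?case using Cons unfolding x
        by (cases g) (auto simp: append[unfolded n] inv[unfolded n] algebra_simps n)
    next
      case 2
      then show ?case using Cons unfolding x
        by (cases g) (auto simp: algebra_simps n)
    }
  qed auto
  have "twisted_conjugate G \<phi> (BS1_elt n u) (BS1_elt n v) \<longleftrightarrow>
    (\<exists>w. (numer n p - 1) * numer n w + numer n q * texp w = numer n u - numer n v \<and>
         texp p * numer n w + (texp q - 1) * texp w = texp u - texp v)"
    unfolding twisted_conjugate_iff[OF \<phi>] eq_iff append subst texp_simps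
    by (intro ex_cong1) (auto simp: algebra_simps)
  also have "\<dots> \<longleftrightarrow> (\<exists>z m. (numer n p - 1) * z + numer n q * m = numer n u - numer n v \<and>
           texp p * z + (texp q - 1) * m = texp u - texp v)"
    using surj by metis
  finally show ?thesis .
qed

text \<open>Comparing \<open>t\<close>-exponents in the image of the relation gives n *
  \<open>texp p\<close> = \<open>texp p\<close>.\<close>

lemma texp_image_a:
  assumes \<phi>: "\<phi> \<in> hom G G" "\<phi> a = BS1_elt n p" "\<phi> t = BS1_elt n q" and n: "n \<noteq> 1"
  shows "texp p = 0"
proof -
  have "BS1_elt n (subst_word p q ((gen_t, False) # gen_pow gen_a n @ [(gen_t, True)])) =
      BS1_elt n (subst_word p q [(gen_a, True)])"
    unfolding hom_elt[OF \<phi>, symmetric] elt_relation ..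
  then have "texp (subst_word p q ((gen_t, False) # gen_pow gen_a n @ [(gen_t, True)])) =
      texp (subst_word p q [(gen_a, True)])"
    unfolding elt_eq_iff by (rule texp_cong)
  then show ?thesis
    using n by (simp add: subst_word_append texp_subst_gen_pow)
qed

text \<open>Comparing translation parts in the image of the relation gives n * alpha = n^(texp q) *
  alpha for alpha = \<open>transl n p\<close>. Injectivity makes alpha nonzero, for otherwise
  \<open>a\<close> would have trivial image.\<close>

lemma power_texp_image_t:
  assumes \<phi>: "\<phi> \<in> hom G G" "\<phi> a = BS1_elt n p" "\<phi> t = BS1_elt n q" and n: "n \<noteq> 0" "n \<noteq> 1"
    and inj: "inj_on \<phi> (carrier G)"
  shows "(of_int n :: rat) powi texp q = of_int n"
proof -
  have p: "texp p = 0"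
    using texp_image_a[OF \<phi> n(2)] .
  have "transl n p \<noteq> 0"
  proof
    assume "transl n p = 0"
    then have "\<phi> a = BS1_elt n []"
      using p n by (simp add: \<phi>(2) BS1_elt_eq_iff)
    moreover have "\<phi> (BS1_elt n []) = BS1_elt n []"
      using hom_elt[OF \<phi>, of "[]"] by simp
    ultimately have "a = BS1_elt n []"
      using inj_onD[OF inj, of a "BS1_elt n []"] by simp
    then show False
      using n by (simp add: a_def BS1_elt_eq_iff)
  qed
  moreover have "BS1_elt n (subst_word p q ((gen_t, False) # gen_pow gen_a n @ [(gen_t, True)])) =
      BS1_elt n (subst_word p q [(gen_a, True)])"
    unfolding hom_elt[OF \<phi>, symmetric] elt_relation ..
  then have "transl n (subst_word p q ((gen_t, False) # gen_pow gen_a n @ [(gen_t, True)])) =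
      transl n (subst_word p q [(gen_a, True)])"
    using n by (simp add: BS1_elt_eq_iff)
  ultimately show ?thesis
    using n p
    by (simp add: subst_word_append transl_append transl_inv_word texp_subst_gen_pow
        transl_subst_gen_pow power_int_minus field_simps)
qed

text \<open>Here \<open>texp\<close> identifies the group with Z, and the endomorphism is
  multiplication by \<open>texp q\<close>.\<close>

lemma twisted_conjugate_iff_0:
  assumes \<phi>: "\<phi> \<in> hom G G" "\<phi> a = BS1_elt n p" "\<phi> t = BS1_elt n q" and n: "n = 0"
  shows "twisted_conjugate G \<phi> (BS1_elt n u) (BS1_elt n v) \<longleftrightarrow> (texp q - 1) dvd (texp u - texp v)"
proof -
  have "texp p = 0"
    using texp_image_a[OF \<phi>] n by simp
  then have "twisted_conjugate G \<phi> (BS1_elt n u) (BS1_elt n v) \<longleftrightarrow>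
      (\<exists>w. texp u - texp v = (texp q - 1) * texp w)"
    by (simp add: twisted_conjugate_iff[OF \<phi>] BS1_0_elt_eq_iff[OF n] texp_subst_word algebra_simps)
      (metis)
  also have "\<dots> \<longleftrightarrow> (texp q - 1) dvd (texp u - texp v)"
    unfolding dvd_def by (metis texp_gen_pow_t)
  finally show ?thesis .
qed

text \<open>
  Write \<open>z\<close> and \<open>m\<close> for the translation part and the \<open>t\<close>-exponent of the conjugator. Comparing
  translation parts and multiplying by \<open>n - 1\<close> gives \<open>(n - 1) (\<alpha> - n\<^bsup>k\<^esup>) z = X - n\<^bsup>m\<^esup> Y\<close>, where \<open>\<alpha>\<close> and
  \<open>\<beta>\<close> are the translation parts of the images of \<open>a\<close> and \<open>t\<close>, \<open>k\<close> is the \<open>t\<close>-exponent of \<open>u\<close>, and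
  \<open>X\<close>, \<open>Y\<close> arise from the translation parts of \<open>u\<close>, \<open>v\<close> by \<open>x \<mapsto> (n - 1) x + \<beta>\<close>. The next two
  definitions are these coefficients with denominators cleared.
\<close>

definition "lin_coeff p u = (n - 1) * (numer n p * n ^ t_inv_count u - n ^ (t_count u + t_inv_count p))"
definition "offset q u v =
  ((n - 1) * numer n u * n ^ t_inv_count q + numer n q * n ^ t_inv_count u)
    * n ^ t_inv_count v"

lemma twisted_conjugate_iff_generic:
  fixes p q u v :: "bs_gen word"
  assumes \<phi>: "\<phi> \<in> hom G G" "\<phi> a = BS1_elt n p" "\<phi> t = BS1_elt n q"
    and inj: "inj_on \<phi> (carrier G)" and n: "n \<noteq> 0" "n \<noteq> 1"
  defines "A \<equiv> lin_coeff p u" and "X \<equiv> offset q u v" and "Y \<equiv> offset q v u"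
  defines "B \<equiv> nat \<bar>A\<bar> + nat \<bar>X\<bar> + nat \<bar>Y\<bar> + nat \<bar>texp u - texp v\<bar> + 2"
  shows "twisted_conjugate G \<phi> (BS1_elt n u) (BS1_elt n v) \<longleftrightarrow>
    (\<exists>i<B. \<exists>j<B. (texp q - 1) * (int j - int i) = texp u - texp v \<and> A dvd n ^ i * X - n ^ j * Y)"
proof -
  define N :: rat where "N = of_int n"
  have N: "N \<noteq> 0" "N \<noteq> 1"
    using n by (simp_all add: N_def)
  have p: "texp p = 0"
    using texp_image_a[OF \<phi> n(2)] .
  have q: "N powi texp q = N"
    unfolding N_def using power_texp_image_t[OF \<phi> n inj] .
  define r where "r = t_inv_count u + t_inv_count p"
  define s where "s = t_inv_count u + t_inv_count v + t_inv_count q"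
  have A: "of_int A / N ^ r = (N - 1) * (transl n p - N powi texp u)"
    using N by (simp add: A_def r_def lin_coeff_def transl_def texp_def power_int_diff power_add
        field_simps flip: N_def)
  have X: "of_int X / N ^ s = (N - 1) * transl n u + transl n q"
    using N by (simp add: X_def s_def offset_def transl_def power_add field_simps flip: N_def)
  have Y: "of_int Y / N ^ s = (N - 1) * transl n v + transl n q"
    using N by (simp add: Y_def s_def offset_def transl_def power_add field_simps flip: N_def)
  \<comment> \<open>Multiplication by N - 1 and collecting z. In the application \<open>M\<close> is
    n^m and \<open>K\<close> is \<open>n\<close> to the \<open>t\<close>-exponent of
    \<open>u\<close>.\<close>
  have eq: "(P * z + b * ((M - 1) / (N - 1)) + M * y = x + K * z) \<longleftrightarrow>
      ((N - 1) * (P - K) * z = ((N - 1) * x + b) - M * ((N - 1) * y + b))" for P z b M y x K :: rat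
    using N by (simp add: field_simps)
  \<comment> \<open>If |n| > 1, powers of |n| determine their exponents, so \<open>q\<close> forces
    \<open>texp q = 1\<close>.\<close>
  have "texp q - 1 = 0 \<or> n = - 1"
  proof (rule disjCI)
    assume "n \<noteq> - 1"
    then have "\<bar>N\<bar> > 1"
      using n by (simp add: N_def flip: of_int_abs)
    moreover have "\<bar>N\<bar> powi texp q = \<bar>N\<bar> powi 1"
      using q by (simp flip: power_int_abs)
    ultimately show "texp q - 1 = 0"
      by (metis diff_self linorder_neqE power_int_strict_increasing less_irrefl)
  qed
  note bounded = ex_exponents_bounded[OF n this HOL.refl]
  have "twisted_conjugate G \<phi> (BS1_elt n u) (BS1_elt n v) \<longleftrightarrow>
    (\<exists>w. texp q * texp w + texp v = texp u + texp w \<and>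
      transl n p * transl n w + transl n q * ((N powi texp w - 1) / (N - 1))
        + N powi (texp q * texp w) * transl n v
      = transl n u + N powi texp u * transl n w)"
    using n p q
    by (simp add: twisted_conjugate_iff[OF \<phi>] BS1_elt_eq_iff texp_subst_word transl_append transl_subst_word N_def)
  also have "\<dots> \<longleftrightarrow> (\<exists>w. (texp q - 1) * texp w = texp u - texp v \<and>
      of_int A / N ^ r * transl n w = of_int X / N ^ s - N powi texp w * (of_int Y / N ^ s))"
    unfolding A X Y power_int_mult q eq by (simp add: algebra_simps)
  \<comment> \<open>Every translation part is an integer over a power of \<open>n\<close>, and every
    pair of coordinates is attained.\<close>
  also have "\<dots> \<longleftrightarrow> (\<exists>c e m. (texp q - 1) * m = texp u - texp v \<and>
      of_int A / N ^ r * (of_int c / N ^ e) = of_int X / N ^ s - N powi m * (of_int Y / N ^ s))"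
    using surj_texp_transl[OF n(1)] transl_def[of n] unfolding N_def by metis
  finally show ?thesis
    unfolding N_def ex_rational_solution_iff[OF n(1)] bounded B_def .
qed

end

section \<open>The decision procedure\<close>

lemma word_code_Nil [simp]: "word_code [] = 0"
  by (simp add: word_code_def)

lemma word_code_Cons: "word_code (x # w) = Suc (prod_encode (letter_code x, word_code w))"
  by (simp add: word_code_def)

lemma tl_code_iter_word_code: "(tl_code ^^ i) (word_code w) = word_code (drop i w)"
proof (induction i arbitrary: w)
  case (Suc i)
  have "tl_code (word_code w) = word_code (tl w)"
    by (cases w) (simp_all add: word_code_Cons tl_code_def)
  then show ?case
    using Suc by (simp add: funpow_Suc_right drop_Suc del: funpow.simps)
qed simp

lemma hd_code_word_code: "hd_code (word_code w) = (if w = [] then 4 else letter_code (hd w))"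
  by (cases w) (simp_all add: word_code_Cons hd_code_def)

lemma length_le_word_code: "length w \<le> word_code w"
proof (induction w)
  case (Cons x w)
  then show ?case
    using le_prod_encode_2[of "word_code w" "letter_code x"] by (simp add: word_code_Cons)
qed simp

text \<open>The code bounds the length, so it can replace the length as summation range: the surplus
  suffixes are empty and contribute 0.\<close>

lemma sum_suffixes_word_code:
  assumes "f [] = 0"
  shows "(\<Sum>i<word_code w. f (drop i w)) = (\<Sum>i<length w. f (drop i w))"
  using length_le_word_code[of w] assms by (intro sum.mono_neutral_right) auto

lemma letter_code_inject: "letter_code x = letter_code y \<longleftrightarrow> x = y"
  by (cases x rule: letter_code.cases; cases y rule: letter_code.cases) auto

lemma letter_code_less: "letter_code x < 4"
  by (cases x rule: letter_code.cases) auto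

text \<open>The range \<open>c\<close> overshoots the length of the word; beyond the end
  \<open>hd_code\<close> returns 4, which matches no letter.\<close>

definition count_code :: "nat \<Rightarrow> nat \<Rightarrow> nat" where
  "count_code l c = (\<Sum>i<c. of_bool (hd_code ((tl_code ^^ i) c) = l))"

lemma count_code_word_code: "count_code (letter_code x) (word_code w) = count_list w x"
proof -
  have "count_code (letter_code x) (word_code w) =
      (\<Sum>i<word_code w. of_bool (drop i w \<noteq> [] \<and> hd (drop i w) = x))"
    unfolding count_code_def tl_code_iter_word_code hd_code_word_code
    using letter_code_less[of x] by (intro sum.cong) (auto simp: letter_code_inject)
  also have "\<dots> = (\<Sum>i<length w. of_bool (drop i w \<noteq> [] \<and> hd (drop i w) = x))"
    by (rule sum_suffixes_word_code[where f = "\<lambda>v. of_bool (v \<noteq> [] \<and> hd v = x)"]) simp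
  also have "\<dots> = count_list w x"
    by (induction w) (auto simp: sum.lessThan_Suc_shift simp del: sum.lessThan_Suc)
  finally show ?thesis .
qed

lemma computable_count_code [computable_intros]:
  assumes "computable k f"
  shows "computable k (\<lambda>xs. count_code l (f xs))"
  unfolding count_code_def
  by (intro computable_intros assms computable_tl[OF assms]) simp

definition texp_code :: "nat \<Rightarrow> int" where
  "texp_code c = int (count_code 2 c) - int (count_code 3 c)"

lemma t_count_code: "count_code 2 (word_code w) = t_count w" "count_code 3 (word_code w) = t_inv_count w"
  using count_code_word_code[of "(gen_t, True)" w] count_code_word_code[of "(gen_t, False)" w] by simp_all

lemma texp_code_word_code: "texp_code (word_code w) = texp w"
  by (simp add: texp_code_def texp_def t_count_code)

lemma int_computable_texp_code [computable_intros]: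
  "computable k f \<Longrightarrow> int_computable k (\<lambda>xs. texp_code (f xs))"
  unfolding texp_code_def by (intro computable_intros)

text \<open>The recursion for \<open>numer\<close> unrolled: a letter \<open>a\<close> or its
  inverse contributes a signed power of \<open>n\<close>, whose exponent counts the letters
  \<open>t\<close> before it and the inverses of \<open>t\<close> after it.\<close>

definition numer_code :: "int \<Rightarrow> nat \<Rightarrow> int" where
  "numer_code n c = (\<Sum>i<c.
     (int (of_bool (hd_code ((tl_code ^^ i) c) = 0)) - int (of_bool (hd_code ((tl_code ^^ i) c) = 1))) *
     n ^ (count_code 2 c - count_code 2 ((tl_code ^^ i) c) + count_code 3 ((tl_code ^^ i) c)))"

lemma int_computable_numer_code [computable_intros]:
  assumes "computable k f"
  shows "int_computable k (\<lambda>xs. numer_code n (f xs))"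
  unfolding numer_code_def
  by (intro computable_intros assms computable_tl[OF assms]; simp)

lemma numer_eq_sum:
  "numer n w = (\<Sum>i<length w.
     (of_bool (drop i w \<noteq> [] \<and> hd (drop i w) = (gen_a, True))
       - of_bool (drop i w \<noteq> [] \<and> hd (drop i w) = (gen_a, False))) *
     n ^ (t_count w - t_count (drop i w) + t_inv_count (drop i w)))"
proof (induction w)
  case (Cons x w)
  \<comment> \<open>The subtraction in the exponent is never truncated, so a leading
    \<open>t\<close> raises the exponent by one.\<close>
  have "t_count (drop i w) \<le> t_count w" for i
    by (metis append_take_drop_id count_list_append le_add2)
  then have Suc: "Suc (t_count w) - t_count (drop i w) = Suc (t_count w - t_count (drop i w))" for i
    by (simp add: Suc_diff_le)
  obtain g s where x: "x = (g, s)" by (cases x)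
  show ?case
    unfolding x using Cons Suc
    by (cases g; cases s)
      (simp_all add: sum.lessThan_Suc_shift sum_distrib_left mult_ac del: sum.lessThan_Suc)
qed simp

lemma numer_code_word_code: "numer_code n (word_code w) = numer n w"
proof -
  define f where "f v = (of_bool (v \<noteq> [] \<and> hd v = (gen_a, True))
      - of_bool (v \<noteq> [] \<and> hd v = (gen_a, False))) *
     n ^ (t_count w - t_count v + t_inv_count v)" for v
  have "letter_code x = 0 \<longleftrightarrow> x = (gen_a, True)" "letter_code x = Suc 0 \<longleftrightarrow> x = (gen_a, False)" for x
    by (cases x rule: letter_code.cases; simp)+
  then have "numer_code n (word_code w) = (\<Sum>i<word_code w. f (drop i w))"
    unfolding numer_code_def tl_code_iter_word_code hd_code_word_code t_count_code f_def
    by (intro sum.cong) auto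
  also have "\<dots> = (\<Sum>i<length w. f (drop i w))"
    by (rule sum_suffixes_word_code) (simp add: f_def)
  also have "\<dots> = numer n w"
    by (simp add: f_def numer_eq_sum)
  finally show ?thesis .
qed

section \<open>Decidability of the coordinate criteria on word codes\<close>

definition code_lin_coeff :: "int \<Rightarrow> nat list \<Rightarrow> int" where
  "code_lin_coeff n xs = (n - 1) * (numer_code n (xs ! 0) * n ^ count_code 3 (xs ! 2)
     - n ^ (count_code 2 (xs ! 2) + count_code 3 (xs ! 0)))"

text \<open>The list holds the codes of the images of \<open>a\<close> and \<open>t\<close> and of
  the two words, in this order; \<open>u\<close> and \<open>v\<close> are positions in it, so that
  one definition serves both offsets.\<close>

definition code_offset :: "int \<Rightarrow> nat \<Rightarrow> nat \<Rightarrow> nat list \<Rightarrow> int" where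
  "code_offset n u v xs =
     ((n - 1) * numer_code n (xs ! u) * n ^ count_code 3 (xs ! 1)
       + numer_code n (xs ! 1) * n ^ count_code 3 (xs ! u)) * n ^ count_code 3 (xs ! v)"

lemma decidable_generic:
  fixes n :: int
  defines "A \<equiv> code_lin_coeff n" and "X \<equiv> code_offset n 2 3" and "Y \<equiv> code_offset n 3 2"
    and "d \<equiv> \<lambda>xs. texp_code (xs ! 2) - texp_code (xs ! 3)"
  defines "B \<equiv> \<lambda>xs. nat \<bar>A xs\<bar> + nat \<bar>X xs\<bar> + nat \<bar>Y xs\<bar> + nat \<bar>d xs\<bar> + 2"
  shows "decidable 4 (\<lambda>xs. \<exists>i<B xs. \<exists>j<B xs.
    (texp_code (xs ! 1) - 1) * (int j - int i) = d xs \<and> A xs dvd n ^ i * X xs - n ^ j * Y xs)"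
proof -
  have comp: "int_computable 4 A" "int_computable 4 X" "int_computable 4 Y" "int_computable 4 d"
    "int_computable 4 (\<lambda>xs. texp_code (xs ! 1) - 1)"
    unfolding A_def X_def Y_def d_def code_lin_coeff_def code_offset_def
    by (intro computable_intros; simp)+
  then have B: "computable 4 B"
    unfolding B_def by (intro computable_intros)
  \<comment> \<open>The coefficients are evaluated under two exponent quantifiers, the inner bound
    \<open>B\<close> under one.\<close>
  note comp' = comp[THEN int_computable_tl, THEN int_computable_tl]
  show ?thesis
    by (intro computable_intros comp' B computable_tl[OF B]) simp_all
qed

lemma decidable_gcd_dvd [computable_intros]:
  assumes "int_computable k f" "int_computable k g" "int_computable k h"
  shows "decidable k (\<lambda>xs. gcd (f xs) (g xs) dvd h xs)"
  unfolding gcd_dvd_iff_bounded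
  by (intro computable_intros assms assms[THEN int_computable_tl]; simp)

lemma decidable_int_linear_system:
  assumes "int_computable k a" "int_computable k b" "int_computable k c" "int_computable k d"
    "int_computable k e" "int_computable k f"
  shows "decidable k (\<lambda>xs. \<exists>z m. a xs * z + b xs * m = e xs \<and> c xs * z + d xs * m = f xs)"
  unfolding ex_linear_system_solution_iff if_bool_eq_conj
  by (intro computable_intros assms)

lemma recf_eval_of_decidable:
  assumes "decidable 4 D"
  obtains r where "\<And>a b c d. recf_eval r [a, b, c, d] (if D [a, b, c, d] then 1 else 0)"
proof -
  obtain r where "\<And>xs. length xs = 4 \<Longrightarrow> recf_eval r xs (of_bool (D xs))"
    using assms unfolding decidable_def computable_def by blast
  then show ?thesis
    by (intro that[of r]) (simp add: of_bool_def flip: of_bool_def)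
qed

theorem theorem3p2:
  fixes n :: int
  shows "\<exists>d. \<forall>\<phi> \<in> auto (BS1 n). \<forall>p q u v.
    \<phi> (BS1_elt n [(gen_a, True)]) = BS1_elt n p \<and>
    \<phi> (BS1_elt n [(gen_t, True)]) = BS1_elt n q \<longrightarrow>
    recf_eval d [word_code p, word_code q, word_code u, word_code v]
      (if twisted_conjugate (BS1 n) \<phi> (BS1_elt n u) (BS1_elt n v) then 1 else 0)"
proof -
  interpret baumslag_solitar n .
  \<comment> \<open>The predicate \<open>D\<close> is chosen before the automorphism and depends on
    \<open>n\<close> alone, as the uniformity of the algorithm requires.\<close>
  have "\<exists>D. decidable 4 D \<and> (\<forall>\<phi> p q u v. \<phi> \<in> hom G G \<longrightarrow> inj_on \<phi> (carrier G) \<longrightarrow>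
      \<phi> a = BS1_elt n p \<longrightarrow> \<phi> t = BS1_elt n q \<longrightarrow>
      (twisted_conjugate G \<phi> (BS1_elt n u) (BS1_elt n v) \<longleftrightarrow>
       D [word_code p, word_code q, word_code u, word_code v]))"
  proof -
    consider "n = 0" | "n = 1" | "n \<noteq> 0" "n \<noteq> 1" by blast
    then show ?thesis
    proof cases
      case 1
      have "decidable 4 (\<lambda>xs. (texp_code (xs ! 1) - 1) dvd (texp_code (xs ! 2) - texp_code (xs ! 3)))"
        by (intro computable_intros; simp)
      then show ?thesis
        by (intro exI conjI allI impI) (assumption, simp add: twisted_conjugate_iff_0[OF _ _ _ 1] texp_code_word_code)
    next
      case 2
      have "decidable 4 (\<lambda>xs. \<exists>z m.
          (numer_code n (xs ! 0) - 1) * z + numer_code n (xs ! 1) * m =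
            numer_code n (xs ! 2) - numer_code n (xs ! 3) \<and>
          texp_code (xs ! 0) * z + (texp_code (xs ! 1) - 1) * m = texp_code (xs ! 2) - texp_code (xs ! 3))"
        by (intro decidable_int_linear_system computable_intros; simp)
      then show ?thesis
        by (intro exI conjI allI impI)
          (assumption, simp add: twisted_conjugate_iff_1[OF _ _ _ 2] texp_code_word_code numer_code_word_code)
    next
      case 3
      from decidable_generic[of n] show ?thesis
        by (intro exI conjI allI impI)
          (assumption, simp add: twisted_conjugate_iff_generic[OF _ _ _ _ 3] texp_code_word_code numer_code_word_code
            t_count_code lin_coeff_def offset_def code_lin_coeff_def code_offset_def)
    qed
  qed
  then obtain D where D: "decidable 4 D" "\<And>\<phi> p q u v. \<phi> \<in> hom G G \<Longrightarrow> inj_on \<phi> (carrier G) \<Longrightarrow>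
      \<phi> a = BS1_elt n p \<Longrightarrow> \<phi> t = BS1_elt n q \<Longrightarrow>
      twisted_conjugate G \<phi> (BS1_elt n u) (BS1_elt n v) \<longleftrightarrow>
       D [word_code p, word_code q, word_code u, word_code v]"
    by blast
  obtain r where r: "\<And>a b c d. recf_eval r [a, b, c, d] (if D [a, b, c, d] then 1 else 0)"
    using recf_eval_of_decidable[OF D(1)] by blast
  show ?thesis
  proof (intro exI[of _ r] ballI allI impI)
    fix \<phi> p q u v
    assume "\<phi> \<in> auto G"
      and "\<phi> (BS1_elt n [(gen_a, True)]) = BS1_elt n p \<and> \<phi> (BS1_elt n [(gen_t, True)]) = BS1_elt n q"
    then have "twisted_conjugate G \<phi> (BS1_elt n u) (BS1_elt n v) \<longleftrightarrow>
        D [word_code p, word_code q, word_code u, word_code v]"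
      by (intro D) (auto simp: auto_def Bij_def bij_betw_def a_def t_def)
    with r show "recf_eval r [word_code p, word_code q, word_code u, word_code v]
        (if twisted_conjugate G \<phi> (BS1_elt n u) (BS1_elt n v) then 1 else 0)"
      by simp
  qed
qed

end
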